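(* Let $\Gamma((r^S)_{S\subseteq I})$ be a quitting game with $r^i_i=0$ for all $i\in I$, with normal players $I_*=[n]$. If the matrix $\hat R$ is an $M$-matrix, then every vector in $\tilde D:=\mathrm{conv}\{r^1,\dots,r^n\}\cap\mathbb R^N_{\ge0}$ is a sunspot equilibrium payoff.
   Context: A quitting game $\Gamma((r^S)_{S\subseteq I})$: finite player set $I=[N]$, vectors $r^S\in[-1,1]^N$ for all $S\subseteq I$; at each stage each player continues or quits; with $t^*$ the first stage at which some player quits and $S^*$ the set of players quitting then ($S^*=\emptyset$ if nobody ever quits), the payoff is $r^{S^*}$. $r^i:=r^{\{i\}}$. Sunspot version: at each stage the players publicly observe a signal uniform on $[0,1]$, independent of the past; strategies are measurable maps $\xi_i^t:[0,1]^t\to[0,1]$ giving player $i$'s quitting probability at stage $t$ (if nobody quit before) as a function of the signals so far; $\gamma(\xi):=\mathbb E_\xi[r^{S^*}]$; $\xi$ is a sunspot $\varepsilon$-equilibrium if no player can gain more than $\varepsilon$ by deviating to any strategy of the extended game. A vector $x\in\mathbb R^N$ is a sunspot equilibrium payoff if it is the limit, as $\varepsilon\to0$, of payoffs $\gamma(\xi^\varepsilon)$ of sunspot $\varepsilon$-equilibria $\xi^\varepsilon$. Normal players: $I_0:=I$, $I_{l+1}:=\{i\in I_l:\ \exists j\in I_l,\ j\neq i,\ r^j_i\le0\}$, $I_*:=\bigcap_l I_l$; $n:=|I_*|$, players renamed so that $I_*=[n]$. $\hat r^i\in\mathbb R^n$ is the restriction of $r^i$ ($i\in[n]$) to coordinates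 in $I_*$, and $\hat R$ is the $n\times n$ matrix with $i$-th column $\hat r^i$. A $Q$-matrix $R$: for every $q\in\mathbb R^n$ there are $z,w\in\mathbb R^n_{\ge0}$ with $w=q+Rz$ and $z_iw_i=0$ for all $i$. Here an $M$-matrix is a $Q$-matrix (with zero diagonal, as $\hat R$ has) in which every row and every column contains exactly one positive entry. *)

theory Defs
  imports "HOL-Probability.Probability"
begin

text \<open>Quitting games. Players form a finite type 'n (so I = UNIV, N = CARD('n)).
  A game is a map r :: 'n set => real^'n, r S being the payoff vector when exactly
  the set S quits first (r {} if nobody ever quits). r^i is r {i}.\<close>

definition quitting_game :: "('n::finite set \<Rightarrow> real^'n) \<Rightarrow> bool" where
  "quitting_game r \<longleftrightarrow> (\<forall>S i. -1 \<le> r S $ i \<and> r S $ i \<le> 1)"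

definition signals :: "(nat \<Rightarrow> real) measure" where
  "signals = PiM UNIV (\<lambda>_::nat. uniform_measure lborel {0..1::real})"

text \<open>A sunspot strategy of one player: sigma t s is the quitting probability at stage t
  (if nobody has quit before) given the signal sequence s; it may depend only on the
  signals s 0, ..., s t observed so far, and must be measurable.\<close>

definition sunspot_strategy :: "(nat \<Rightarrow> (nat \<Rightarrow> real) \<Rightarrow> real) \<Rightarrow> bool" where
  "sunspot_strategy \<sigma> \<longleftrightarrow>
     (\<forall>t. \<sigma> t \<in> borel_measurable signals
        \<and> (\<forall>s. 0 \<le> \<sigma> t s \<and> \<sigma> t s \<le> 1)
        \<and> (\<forall>s s'. (\<forall>k\<le>t. s k = s' k) \<longrightarrow> \<sigma> t s = \<sigma> t s'))"

definition sunspot_profile :: "('n::finite \<Rightarrow> nat \<Rightarrow> (nat \<Rightarrow> real) \<Rightarrow> real) \<Rightarrow> bool" where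
  "sunspot_profile \<xi> \<longleftrightarrow> (\<forall>i. sunspot_strategy (\<xi> i))"

definition cont_prob :: "('n::finite \<Rightarrow> nat \<Rightarrow> (nat \<Rightarrow> real) \<Rightarrow> real) \<Rightarrow> nat \<Rightarrow> (nat \<Rightarrow> real) \<Rightarrow> real" where
  "cont_prob \<xi> t s = (\<Prod>u<t. \<Prod>i\<in>UNIV. 1 - \<xi> i u s)"

definition quit_prob :: "('n::finite \<Rightarrow> nat \<Rightarrow> (nat \<Rightarrow> real) \<Rightarrow> real) \<Rightarrow> nat \<Rightarrow> 'n set \<Rightarrow> (nat \<Rightarrow> real) \<Rightarrow> real" where
  "quit_prob \<xi> t S s = cont_prob \<xi> t s * (\<Prod>i\<in>S. \<xi> i t s) * (\<Prod>i\<in>UNIV - S. 1 - \<xi> i t s)"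

definition never_prob :: "('n::finite \<Rightarrow> nat \<Rightarrow> (nat \<Rightarrow> real) \<Rightarrow> real) \<Rightarrow> (nat \<Rightarrow> real) \<Rightarrow> real" where
  "never_prob \<xi> s = lim (\<lambda>t. cont_prob \<xi> t s)"

definition cond_payoff :: "('n::finite set \<Rightarrow> real^'n) \<Rightarrow> ('n \<Rightarrow> nat \<Rightarrow> (nat \<Rightarrow> real) \<Rightarrow> real) \<Rightarrow> (nat \<Rightarrow> real) \<Rightarrow> real^'n" where
  "cond_payoff r \<xi> s =
     (\<Sum>t. \<Sum>S\<in>UNIV - {{}}. quit_prob \<xi> t S s *\<^sub>R r S) + never_prob \<xi> s *\<^sub>R r {}"

definition payoff :: "('n::finite set \<Rightarrow> real^'n) \<Rightarrow> ('n \<Rightarrow> nat \<Rightarrow> (nat \<Rightarrow> real) \<Rightarrow> real) \<Rightarrow> real^'n" where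
  "payoff r \<xi> = integral\<^sup>L signals (cond_payoff r \<xi>)"

definition sunspot_eps_equilibrium :: "('n::finite set \<Rightarrow> real^'n) \<Rightarrow> real \<Rightarrow> ('n \<Rightarrow> nat \<Rightarrow> (nat \<Rightarrow> real) \<Rightarrow> real) \<Rightarrow> bool" where
  "sunspot_eps_equilibrium r \<epsilon> \<xi> \<longleftrightarrow> sunspot_profile \<xi> \<and>
     (\<forall>i \<eta>. sunspot_strategy \<eta> \<longrightarrow> payoff r (\<xi>(i := \<eta>)) $ i \<le> payoff r \<xi> $ i + \<epsilon>)"

definition sunspot_eq_payoff :: "('n::finite set \<Rightarrow> real^'n) \<Rightarrow> real^'n \<Rightarrow> bool" where
  "sunspot_eq_payoff r x \<longleftrightarrow>
     (\<exists>\<Xi> :: real \<Rightarrow> ('n \<Rightarrow> nat \<Rightarrow> (nat \<Rightarrow> real) \<Rightarrow> real).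
        (\<forall>\<epsilon>>0. sunspot_eps_equilibrium r \<epsilon> (\<Xi> \<epsilon>)) \<and>
        ((\<lambda>\<epsilon>. payoff r (\<Xi> \<epsilon>)) \<longlongrightarrow> x) (at_right 0))"

primrec normal_iter :: "('n::finite set \<Rightarrow> real^'n) \<Rightarrow> nat \<Rightarrow> 'n set" where
  "normal_iter r 0 = UNIV"
| "normal_iter r (Suc l) =
     {i \<in> normal_iter r l. \<exists>j\<in>normal_iter r l. j \<noteq> i \<and> r {j} $ i \<le> 0}"

definition normal_players :: "('n::finite set \<Rightarrow> real^'n) \<Rightarrow> 'n set" where
  "normal_players r = (\<Inter>l. normal_iter r l)"

definition Q_matrix :: "'a set \<Rightarrow> ('a \<Rightarrow> 'a \<Rightarrow> real) \<Rightarrow> bool" where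
  "Q_matrix K R \<longleftrightarrow> (\<forall>q :: 'a \<Rightarrow> real. \<exists>z w :: 'a \<Rightarrow> real.
      \<forall>i\<in>K. z i \<ge> 0 \<and> w i \<ge> 0 \<and> w i = q i + (\<Sum>j\<in>K. R i j * z j) \<and> z i * w i = 0)"

definition M_matrix :: "'a set \<Rightarrow> ('a \<Rightarrow> 'a \<Rightarrow> real) \<Rightarrow> bool" where
  "M_matrix K R \<longleftrightarrow> Q_matrix K R \<and> (\<forall>i\<in>K. R i i = 0)
     \<and> (\<forall>i\<in>K. \<exists>!j. j \<in> K \<and> R i j > 0) \<and> (\<forall>j\<in>K. \<exists>!i. i \<in> K \<and> R i j > 0)"

text \<open>hat R: rows and columns indexed by normal players, j-th column is r^j restricted.\<close>

definition hatR :: "('n::finite set \<Rightarrow> real^'n) \<Rightarrow> 'n \<Rightarrow> 'n \<Rightarrow> real" where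
  "hatR r i j = r {j} $ i"

end

theory Submission
  imports Defs
begin

text \<open>
  Restricted to the normal players, the matrix \<open>hatR r\<close> is, up to a permutation of its columns, a nonsingular
  M-matrix in the classical sense, so it has a nonnegative inverse. Hence the payoffs in
  \<open>conv {r\<^sup>1, \<dots>, r\<^sup>n}\<close> that are nonnegative form a simplex, with one vertex \<open>v k\<close>
  per normal player \<open>k\<close>, at which all normal players but \<open>k\<close> get \<open>0\<close>. Let \<open>J k\<close> be
  the player with \<open>r {J k} $ k > 0\<close>. At \<open>v k\<close> she gets \<open>0\<close> whether she quits alone or not, and
  \<open>v k = \<mu> r {J k} + (1 - \<mu>) y\<close> with \<open>y\<close> again in the simplex if \<open>\<mu>\<close> is small. So the public
  signals can drive a Markov chain on the vertices: in state \<open>k\<close> player \<open>J k\<close> quits with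
  probability \<open>\<mu>\<close>, and the next state has mean \<open>y\<close>.

  If \<open>r {J k} = v k\<close>, then \<open>y = v k\<close> and player \<open>J k\<close> could stay in the game forever. Therefore
  the chain moves, with probability \<open>\<rho> = \<mu>\<^sup>2\<close>, to a state \<open>\<kappa> k\<close> different from \<open>k\<close> and \<open>J k\<close>;
  it exists because every row of a Q-matrix of this shape has a negative entry. This keeps
  \<open>J k\<close> at payoff \<open>0\<close>, and it distorts the payoffs by at most \<open>\<rho> / \<mu>\<close> in total because the
  others are absorbed at rate \<open>\<mu>\<close>. A deviator gains at most \<open>\<mu>\<close> more, from quitting
  simultaneously with \<open>J k\<close>.
\<close>

subsection \<open>Public signals\<close>

abbreviation unit_uniform :: "real measure" where
  "unit_uniform \<equiv> uniform_measure lborel {0..1}"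

lemma prob_space_unit_uniform: "prob_space unit_uniform"
  by (rule prob_space_uniform_measure) auto

text \<open>The intervals are laid end to end: the one added for \<open>a\<close> starts at
  \<open>sum p A\<close>, where the earlier ones stop. Weight 0 gives an empty interval.\<close>

lemma partition_interval:
  fixes p :: "'a \<Rightarrow> real"
  assumes "finite A" "\<And>l. l \<in> A \<Longrightarrow> p l \<ge> 0"
  shows "\<exists>c. disjoint_family_on (\<lambda>l. {c l..<c l + p l}) A
    \<and> (\<Union>l\<in>A. {c l..<c l + p l}) = {0..<sum p A}"
  using assms
proof (induction A rule: finite_induct)
  case (insert a A)
  then obtain c where c: "disjoint_family_on (\<lambda>l. {c l..<c l + p l}) A"
    "(\<Union>l\<in>A. {c l..<c l + p l}) = {0..<sum p A}"
    by auto
  define c' where "c' = c(a := sum p A)"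
  have eq: "c' l = c l" if "l \<in> A" for l
    using that insert.hyps by (auto simp: c'_def)
  have un: "(\<Union>l\<in>A. {c' l..<c' l + p l}) = {0..<sum p A}"
    using c(2) eq by simp
  have "disjoint_family_on (\<lambda>l. {c' l..<c' l + p l}) A"
    using c(1) eq by (simp add: disjoint_family_on_def)
  moreover have "{c' a..<c' a + p a} \<inter> (\<Union>l\<in>A. {c' l..<c' l + p l}) = {}"
    unfolding un by (auto simp: c'_def)
  ultimately have "disjoint_family_on (\<lambda>l. {c' l..<c' l + p l}) (insert a A)"
    using insert.hyps by (subst disjoint_family_on_insert) auto
  moreover have "(\<Union>l\<in>insert a A. {c' l..<c' l + p l}) = {0..<sum p (insert a A)}"
  proof -
    have "sum p A \<ge> 0" "p a \<ge> 0"
      using insert.prems by (auto intro: sum_nonneg)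
    then have "{c' a..<c' a + p a} \<union> {0..<sum p A} = {0..<p a + sum p A}"
      by (auto simp: c'_def)
    then show ?thesis
      using un insert.hyps by simp
  qed
  ultimately show ?case by blast
qed (simp add: disjoint_family_on_def)

text \<open>A single uniform signal can carry any lottery over finitely many outcomes:
  \<open>g\<close> returns the outcome whose interval, of length \<open>p l\<close>, contains the
  signal.\<close>

lemma sample_finite_distribution:
  fixes p :: "'a::finite \<Rightarrow> real"
  assumes nonneg: "\<And>l. p l \<ge> 0" and total: "sum p UNIV = 1"
  shows "\<exists>g \<in> borel \<rightarrow>\<^sub>M count_space UNIV.
    \<forall>f :: 'a \<Rightarrow> real. (\<integral>u. f (g u) \<partial>unit_uniform) = (\<Sum>l\<in>UNIV. p l * f l)"
proof -
  interpret prob_space unit_uniform by (rule prob_space_unit_uniform)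
  obtain c where disj: "disjoint_family_on (\<lambda>l. {c l..<c l + p l}) UNIV"
    and un: "(\<Union>l. {c l..<c l + p l}) = {0..<1}"
    using partition_interval[of UNIV p] nonneg total by auto
  define B where "B l = {c l..<c l + p l}" for l
  have B [measurable]: "B l \<in> sets borel" for l
    by (simp add: B_def)
  \<comment> \<open>The default \<open>undefined\<close> is taken only on a null set (the endpoint 1
    included), yet it has to be counted in the preimages \<open>vimage\<close>.\<close>
  define g where "g u = (if u \<in> {0..<1} then THE l. u \<in> B l else undefined)" for u
  have uniq: "l = l'" if "u \<in> B l" "u \<in> B l'" for u l l'
    using disj that unfolding disjoint_family_on_def B_def by blast
  have B_eq: "g u = l" if "u \<in> B l" for u l
  proof -
    have "u \<in> {0..<1}"
      using un that by (auto simp: B_def)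
    moreover have "(THE l. u \<in> B l) = l"
      using uniq that by blast
    ultimately show ?thesis by (simp add: g_def)
  qed
  have ex: "\<exists>l. u \<in> B l" if "u \<in> {0..<1}" for u
    using that un unfolding B_def by blast
  have vimage: "g -` {l} = B l \<union> (if l = undefined then - {0..<1} else {})" for l
  proof (rule set_eqI)
    fix u
    show "u \<in> g -` {l} \<longleftrightarrow> u \<in> B l \<union> (if l = undefined then - {0..<1} else {})"
    proof (cases "u \<in> {0..<1}")
      case True
      then obtain l' where "u \<in> B l'" using ex by blast
      with True B_eq[OF this] uniq show ?thesis by auto
    next
      case False
      moreover from this have "u \<notin> B l" using un unfolding B_def by blast
      ultimately show ?thesis by (auto simp: g_def)
    qed
  qed
  have g: "g \<in> borel \<rightarrow>\<^sub>M count_space UNIV"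
    by (rule measurable_count_space_eq2[THEN iffD2]) (auto simp: vimage B_def)
  have "(\<integral>u. f (g u) \<partial>unit_uniform) = (\<Sum>l\<in>UNIV. p l * f l)" for f :: "'a \<Rightarrow> real"
  proof -
    have "AE u in unit_uniform. u \<in> {0..<1}"
    proof -
      have "AE u in lborel. u \<noteq> (1::real)"
        by (rule AE_lborel_singleton)
      then show ?thesis
        by (intro AE_uniform_measureI) (auto elim!: AE_mp)
    qed
    then have "AE u in unit_uniform. f (g u) = (\<Sum>l\<in>UNIV. f l * indicator (B l) u)"
    proof eventually_elim
      case (elim u)
      then obtain l where l: "u \<in> B l" using ex by blast
      then have "u \<in> B l' \<longleftrightarrow> l' = l" for l'
        using B_eq by blast
      then show ?case
        using B_eq[OF l] by (simp add: indicator_def of_bool_def if_distrib cong: if_cong)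
    qed
    moreover have "(\<lambda>u. f (g u)) \<in> borel_measurable unit_uniform"
      using g by measurable
    moreover have "(\<lambda>u. \<Sum>l\<in>UNIV. f l * indicator (B l) u) \<in> borel_measurable unit_uniform"
      by measurable
    ultimately have "(\<integral>u. f (g u) \<partial>unit_uniform) = (\<integral>u. (\<Sum>l\<in>UNIV. f l * indicator (B l) u) \<partial>unit_uniform)"
      by (intro integral_cong_AE)
    also have "\<dots> = (\<Sum>l\<in>UNIV. f l * prob (B l))"
    proof -
      have "integrable unit_uniform (indicat_real (B l))" for l
        by (intro integrable_const_bound[of _ 1]) auto
      then show ?thesis
        by (subst Bochner_Integration.integral_sum) auto
    qed
    also have "\<dots> = (\<Sum>l\<in>UNIV. p l * f l)"
    proof (intro sum.cong refl)
      fix l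
      have "B l \<subseteq> {0..<1}" using un unfolding B_def by blast
      then have "B l \<subseteq> {0..1}" by auto
      then have "prob (B l) = measure lborel (B l)"
        using measure_uniform_measure[of lborel "{0..1::real}" "B l"]
        by (simp add: Int_absorb1 B_def)
      then show "f l * prob (B l) = p l * f l"
        using nonneg[of l] by (simp add: B_def)
    qed
    finally show ?thesis .
  qed
  with g show ?thesis by blast
qed

lemma prob_space_signals: "prob_space signals"
  unfolding signals_def by (intro prob_space_PiM prob_space_unit_uniform)

lemma sets_signals: "sets signals = sets (PiM UNIV (\<lambda>_::nat. borel :: real measure))"
  unfolding signals_def by (intro sets_PiM_cong) auto

lemma space_signals [simp]: "space signals = UNIV"
  unfolding signals_def by (simp add: space_PiM)

lemma measurable_signal [measurable]: "(\<lambda>s. s t) \<in> signals \<rightarrow>\<^sub>M borel"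
  using measurable_component_singleton[of t UNIV "\<lambda>_. borel"]
  by (simp cong: measurable_cong_sets add: measurable_cong_sets[OF sets_signals refl])

lemma distr_signal: "distr signals borel (\<lambda>s. s t) = unit_uniform"
proof -
  have "distr signals unit_uniform (\<lambda>s. s t) = unit_uniform"
    unfolding signals_def
    by (rule distr_PiM_component[where M = "\<lambda>_. unit_uniform" and I = UNIV])
      (auto intro: prob_space_unit_uniform)
  moreover have "distr signals unit_uniform (\<lambda>s. s t) = distr signals borel (\<lambda>s. s t)"
    by (rule distr_cong) auto
  ultimately show ?thesis by simp
qed

lemma integral_signal:
  fixes G :: "real \<Rightarrow> real"
  assumes "G \<in> borel_measurable borel"
  shows "(\<integral>s. G (s t) \<partial>signals) = (\<integral>u. G u \<partial>unit_uniform)"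
  using integral_distr[of "\<lambda>s. s t" signals borel G] assms by (simp add: distr_signal)

text \<open>The joint law of the coordinates is \<open>signals\<close> itself, by definition the
  product of their laws; this is the criterion for independence.\<close>

lemma indep_signals: "prob_space.indep_vars signals (\<lambda>_. borel) (\<lambda>t s. s t) UNIV"
proof -
  interpret prob_space signals by (rule prob_space_signals)
  have "distr signals (PiM UNIV (\<lambda>_. borel)) (\<lambda>s. \<lambda>i\<in>UNIV. s i) = signals"
    using distr_id2[of "PiM UNIV (\<lambda>_. borel)" signals] by (simp add: sets_signals restrict_def)
  then show ?thesis
    by (subst indep_vars_iff_distr_eq_PiM) (simp_all add: distr_signal signals_def[symmetric])
qed

text \<open>Adaptedness to the public signals, in the pointwise form used in
  \<open>sunspot_strategy\<close> instead of a filtration of sigma-algebras.\<close>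

definition depends_upto :: "nat \<Rightarrow> ((nat \<Rightarrow> real) \<Rightarrow> 'b) \<Rightarrow> bool" where
  "depends_upto t F \<longleftrightarrow> (\<forall>s s'. (\<forall>k\<le>t. s k = s' k) \<longrightarrow> F s = F s')"

text \<open>The past and the next signal are independent, so the expectation factors. The Markov
  property in \<open>integral_next_state\<close> comes from here.\<close>

lemma integral_signals_mult_next:
  fixes F :: "(nat \<Rightarrow> real) \<Rightarrow> real" and G :: "real \<Rightarrow> real"
  assumes F: "F \<in> borel_measurable signals" "depends_upto t F" "\<And>s. \<bar>F s\<bar> \<le> B"
    and G: "G \<in> borel_measurable borel" "\<And>u. \<bar>G u\<bar> \<le> B'"
  shows "(\<integral>s. F s * G (s (Suc t)) \<partial>signals) = (\<integral>s. F s \<partial>signals) * (\<integral>u. G u \<partial>unit_uniform)"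
proof -
  interpret prob_space signals by (rule prob_space_signals)
  \<comment> \<open>\<open>ext\<close> pads a finite history with zeros. Since \<open>F\<close>
    ignores later signals, it factors measurably through the restriction to
    \<open>{..t}\<close>.\<close>
  define ext where "ext \<omega> = (\<lambda>i. if i \<le> t then \<omega> i else 0)" for \<omega> :: "nat \<Rightarrow> real"
  have ext: "ext \<in> PiM {..t} (\<lambda>_. borel) \<rightarrow>\<^sub>M signals"
  proof -
    have "ext \<in> PiM {..t} (\<lambda>_. borel) \<rightarrow>\<^sub>M PiM UNIV (\<lambda>_. borel)"
      unfolding ext_def
    proof (rule measurable_PiM_single')
      fix i
      show "(\<lambda>\<omega>. if i \<le> t then \<omega> i else 0) \<in> PiM {..t} (\<lambda>_. borel) \<rightarrow>\<^sub>M (borel :: real measure)"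
        by (cases "i \<le> t") auto
    qed auto
    then show ?thesis
      by (simp add: measurable_cong_sets[OF refl sets_signals])
  qed
  have F_eq: "F = (F \<circ> ext) \<circ> (\<lambda>s. restrict s {..t})"
    using F(2) by (auto simp: fun_eq_iff depends_upto_def ext_def)
  have "indep_var (PiM {..t} (\<lambda>_. borel)) (\<lambda>s. restrict s {..t})
      (PiM {Suc t} (\<lambda>_. borel)) (\<lambda>s. restrict s {Suc t})"
    using indep_var_restrict[OF indep_signals, of "{..t}" "{Suc t}"] by auto
  then have "indep_var borel ((F \<circ> ext) \<circ> (\<lambda>s. restrict s {..t}))
      borel ((\<lambda>\<omega>. G (\<omega> (Suc t))) \<circ> (\<lambda>s. restrict s {Suc t}))"
    using F(1) G(1) ext by (intro indep_var_compose) (auto intro: measurable_comp)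
  moreover have "(\<lambda>\<omega>. G (\<omega> (Suc t))) \<circ> (\<lambda>s. restrict s {Suc t}) = (\<lambda>s. G (s (Suc t)))"
    by auto
  ultimately have "indep_var borel F borel (\<lambda>s. G (s (Suc t)))"
    unfolding F_eq[symmetric] by simp
  moreover have "integrable signals F"
    using F by (intro integrable_const_bound[of _ B]) auto
  moreover have "integrable signals (\<lambda>s. G (s (Suc t)))"
    using G by (intro integrable_const_bound[of _ B'] measurable_compose[OF measurable_signal]) auto
  ultimately show ?thesis
    using indep_var_lebesgue_integral[of F "\<lambda>s. G (s (Suc t))"] integral_signal[OF G(1)] by simp
qed

subsection \<open>Payoffs of sunspot profiles\<close>

lemma cont_prob_0 [simp]: "cont_prob \<xi> 0 s = 1"
  by (simp add: cont_prob_def)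

lemma cont_prob_Suc: "cont_prob \<xi> (Suc t) s = cont_prob \<xi> t s * (\<Prod>i\<in>UNIV. 1 - \<xi> i t s)"
  by (simp add: cont_prob_def)

lemma sunspot_profileD:
  assumes "sunspot_profile \<xi>"
  shows "\<xi> i t \<in> borel_measurable signals" "0 \<le> \<xi> i t s" "\<xi> i t s \<le> 1" "depends_upto t (\<xi> i t)"
  using assms by (auto simp: sunspot_profile_def sunspot_strategy_def depends_upto_def)

lemma cont_prob_nonneg: "sunspot_profile \<xi> \<Longrightarrow> 0 \<le> cont_prob \<xi> t s"
  unfolding cont_prob_def by (intro prod_nonneg) (auto simp: sunspot_profileD)

lemma cont_prob_Suc_le:
  assumes "sunspot_profile \<xi>"
  shows "cont_prob \<xi> (Suc t) s \<le> cont_prob \<xi> t s"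
proof -
  have "(\<Prod>i\<in>UNIV. 1 - \<xi> i t s) \<le> 1"
    using assms by (intro prod_le_1) (auto simp: sunspot_profileD)
  then show ?thesis
    unfolding cont_prob_Suc using cont_prob_nonneg[OF assms] sunspot_profileD(3)[OF assms]
    by (intro mult_right_le_one_le prod_nonneg) auto
qed

lemma cont_prob_le_1: "sunspot_profile \<xi> \<Longrightarrow> cont_prob \<xi> t s \<le> 1"
  by (induction t) (auto intro: order.trans[OF cont_prob_Suc_le])

lemma measurable_cont_prob:
  assumes "sunspot_profile \<xi>"
  shows "cont_prob \<xi> t \<in> borel_measurable signals"
proof -
  note [measurable] = sunspot_profileD(1)[OF assms]
  show ?thesis unfolding cont_prob_def[abs_def] by measurable
qed

lemma measurable_quit_prob:
  assumes "sunspot_profile \<xi>"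
  shows "quit_prob \<xi> t S \<in> borel_measurable signals"
proof -
  note [measurable] = sunspot_profileD(1)[OF assms] measurable_cont_prob[OF assms]
  show ?thesis unfolding quit_prob_def[abs_def] by measurable
qed

text \<open>Survival to stage \<open>Suc t\<close> is decided by the stages up to \<open>t\<close>,
  hence before the signal of stage \<open>Suc t\<close> is drawn. This shift by one lets it be
  paired with the next state.\<close>

lemma depends_upto_cont_prob:
  assumes "sunspot_profile \<xi>"
  shows "depends_upto t (cont_prob \<xi> (Suc t))"
  unfolding depends_upto_def cont_prob_def
proof (intro allI impI prod.cong refl)
  fix s s' :: "nat \<Rightarrow> real" and u i
  assume "\<forall>k\<le>t. s k = s' k" "u \<in> {..<Suc t}"
  then have "\<xi> i u s = \<xi> i u s'"
    using sunspot_profileD(4)[OF assms] by (force simp: depends_upto_def)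
  then show "1 - \<xi> i u s = 1 - \<xi> i u s'" by simp
qed

lemma quit_prob_nonneg:
  assumes "sunspot_profile \<xi>"
  shows "0 \<le> quit_prob \<xi> t S s"
  unfolding quit_prob_def using cont_prob_nonneg[OF assms] sunspot_profileD(2,3)[OF assms]
  by (intro mult_nonneg_nonneg prod_nonneg) auto

text \<open>Expanding the product over all players of
  \<open>\<xi> i t s + (1 - \<xi> i t s)\<close>, which is 1, sums over all coalitions; the empty
  one stands for survival to the next stage.\<close>

lemma sum_quit_prob:
  "(\<Sum>S\<in>UNIV - {{}}. quit_prob \<xi> t S s) = cont_prob \<xi> t s - cont_prob \<xi> (Suc t) s"
proof -
  have "(\<Sum>S\<in>UNIV. quit_prob \<xi> t S s) =
      cont_prob \<xi> t s * (\<Sum>S\<in>Pow UNIV. (\<Prod>i\<in>S. \<xi> i t s) * (\<Prod>i\<in>UNIV - S. 1 - \<xi> i t s))"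
    by (simp add: quit_prob_def sum_distrib_left mult.assoc)
  also have "\<dots> = cont_prob \<xi> t s"
    by (subst prod_add[symmetric]) simp_all
  finally show ?thesis
    by (simp add: sum_diff1 quit_prob_def cont_prob_Suc)
qed

text \<open>The contribution of stage \<open>t\<close> is not conditional on reaching that stage,
  since \<open>quit_prob\<close> contains the factor \<open>cont_prob\<close>.\<close>

definition stage_payoff ::
  "('n::finite set \<Rightarrow> real^'n) \<Rightarrow> ('n \<Rightarrow> nat \<Rightarrow> (nat \<Rightarrow> real) \<Rightarrow> real) \<Rightarrow> 'n \<Rightarrow> nat \<Rightarrow> (nat \<Rightarrow> real) \<Rightarrow> real" where
  "stage_payoff r \<xi> i t s = (\<Sum>S\<in>UNIV - {{}}. quit_prob \<xi> t S s * r S $ i)"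

lemma measurable_stage_payoff:
  assumes "sunspot_profile \<xi>"
  shows "stage_payoff r \<xi> i t \<in> borel_measurable signals"
proof -
  note [measurable] = measurable_quit_prob[OF assms]
  show ?thesis unfolding stage_payoff_def[abs_def] by measurable
qed

lemma abs_payoff_le_1: "quitting_game r \<Longrightarrow> \<bar>r S $ i\<bar> \<le> 1"
  by (force simp: quitting_game_def abs_le_iff)

lemma abs_stage_payoff_le:
  assumes "sunspot_profile \<xi>" "quitting_game r"
  shows "\<bar>stage_payoff r \<xi> i t s\<bar> \<le> cont_prob \<xi> t s - cont_prob \<xi> (Suc t) s"
proof -
  have "\<bar>stage_payoff r \<xi> i t s\<bar> \<le> (\<Sum>S\<in>UNIV - {{}}. \<bar>quit_prob \<xi> t S s * r S $ i\<bar>)"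
    unfolding stage_payoff_def by (rule sum_abs)
  also have "\<dots> \<le> (\<Sum>S\<in>UNIV - {{}}. quit_prob \<xi> t S s)"
    using quit_prob_nonneg[OF assms(1)] abs_payoff_le_1[OF assms(2)]
    by (intro sum_mono) (auto simp: abs_mult intro: mult_left_le)
  finally show ?thesis by (simp add: sum_quit_prob)
qed

lemma cont_prob_tendsto_never_prob:
  assumes "sunspot_profile \<xi>"
  shows "(\<lambda>t. cont_prob \<xi> t s) \<longlonglongrightarrow> never_prob \<xi> s"
proof -
  have "decseq (\<lambda>t. cont_prob \<xi> t s)"
    using cont_prob_Suc_le[OF assms] by (intro decseq_SucI)
  then have "convergent (\<lambda>t. cont_prob \<xi> t s)"
    using cont_prob_nonneg[OF assms] by (metis convergentI decseq_convergent)
  then show ?thesis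
    unfolding never_prob_def by (simp add: convergent_LIMSEQ_iff)
qed

text \<open>After \<open>T\<close> stages the mass \<open>cont_prob \<xi> T s\<close> is left. It
  splits into later absorption, \<open>?C T - ?L\<close> by telescoping, and never quitting,
  \<open>?L\<close>; payoffs are bounded by 1.\<close>

lemma cond_payoff_tail:
  assumes \<xi>: "sunspot_profile \<xi>" and r: "quitting_game r"
  shows "\<bar>cond_payoff r \<xi> s $ i - (\<Sum>t<T. stage_payoff r \<xi> i t s)\<bar> \<le> cont_prob \<xi> T s"
proof -
  let ?C = "\<lambda>t. cont_prob \<xi> t s" and ?L = "never_prob \<xi> s"
  let ?v = "\<lambda>t. \<Sum>S\<in>UNIV - {{}}. quit_prob \<xi> t S s *\<^sub>R r S"
  note lim = cont_prob_tendsto_never_prob[OF \<xi>, of s]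
  have v_nth: "?v t $ j = stage_payoff r \<xi> j t s" for t j
    by (simp add: stage_payoff_def)
  have diff: "(\<lambda>t. ?C t - ?C (Suc t)) sums (1 - ?L)"
    using telescope_sums'[OF lim] by simp
  \<comment> \<open>The crude factor \<open>CARD('a)\<close> serves only to make the vector series
    summable, so that coordinates can be taken term by term.\<close>
  have norm_v: "norm (?v t) \<le> real CARD('a) * (?C t - ?C (Suc t))" for t
  proof -
    have "norm (?v t) \<le> (\<Sum>j\<in>UNIV. \<bar>?v t $ j\<bar>)"
      by (rule norm_le_l1_cart)
    also have "\<dots> \<le> (\<Sum>j\<in>(UNIV::'a set). ?C t - ?C (Suc t))"
      unfolding v_nth using abs_stage_payoff_le[OF \<xi> r] by (intro sum_mono)
    finally show ?thesis by simp
  qed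
  have "summable (\<lambda>t. real CARD('a) * (?C t - ?C (Suc t)))"
    using diff by (intro summable_mult) (simp add: sums_iff)
  then have "summable ?v"
    by (rule summable_comparison_test'[where N = 0]) (rule norm_v)
  then have nth: "(\<Sum>t. ?v t) $ i = (\<Sum>t. stage_payoff r \<xi> i t s)"
    and sum: "summable (\<lambda>t. stage_payoff r \<xi> i t s)"
    using bounded_linear.suminf[OF bounded_linear_vec_nth, of ?v i]
      bounded_linear.summable[OF bounded_linear_vec_nth, of ?v i]
    by (simp_all add: v_nth del: sum_component)
  have tail: "(\<lambda>t. ?C (t + T) - ?C (Suc t + T)) sums (?C T - ?L)"
    using telescope_sums'[OF LIMSEQ_ignore_initial_segment[OF lim, of T]] by simp
  have "\<bar>\<Sum>t. stage_payoff r \<xi> i (t + T) s\<bar> \<le> (\<Sum>t. ?C (t + T) - ?C (Suc t + T))"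
    unfolding real_norm_def[symmetric]
  proof (rule norm_suminf_le)
    show "norm (stage_payoff r \<xi> i (t + T) s) \<le> ?C (t + T) - ?C (Suc t + T)" for t
      using abs_stage_payoff_le[OF \<xi> r, of i "t + T" s] by simp
    show "summable (\<lambda>t. ?C (t + T) - ?C (Suc t + T))"
      using tail by (rule sums_summable)
  qed
  also have "\<dots> = ?C T - ?L"
    using tail by (rule sums_unique[symmetric])
  finally have "\<bar>\<Sum>t. stage_payoff r \<xi> i (t + T) s\<bar> \<le> ?C T - ?L" .
  moreover have "\<bar>?L * r {} $ i\<bar> \<le> ?L"
    using LIMSEQ_le_const[OF lim, of 0] cont_prob_nonneg[OF \<xi>] abs_payoff_le_1[OF r]
    by (auto simp: abs_mult intro: mult_left_le)
  moreover have "cond_payoff r \<xi> s $ i - (\<Sum>t<T. stage_payoff r \<xi> i t s)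
      = (\<Sum>t. stage_payoff r \<xi> i (t + T) s) + ?L * r {} $ i"
    using suminf_split_initial_segment[OF sum, of T] nth by (simp add: cond_payoff_def)
  ultimately show ?thesis by linarith
qed

lemma measurable_cond_payoff:
  assumes "sunspot_profile \<xi>"
  shows "cond_payoff r \<xi> \<in> borel_measurable signals"
proof -
  note [measurable] = measurable_quit_prob[OF assms] measurable_cont_prob[OF assms]
  show ?thesis unfolding cond_payoff_def[abs_def] never_prob_def by measurable
qed

text \<open>Payoffs can thus be estimated over finitely many stages, at a cost that
  \<open>absorption\<close> later sends to 0.\<close>

lemma payoff_tail:
  assumes \<xi>: "sunspot_profile \<xi>" and r: "quitting_game r"
  shows "\<bar>payoff r \<xi> $ i - (\<integral>s. (\<Sum>t<T. stage_payoff r \<xi> i t s) \<partial>signals)\<bar>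
    \<le> (\<integral>s. cont_prob \<xi> T s \<partial>signals)"
proof -
  interpret prob_space signals by (rule prob_space_signals)
  note [measurable] = measurable_cond_payoff[OF \<xi>] measurable_stage_payoff[OF \<xi>] measurable_cont_prob[OF \<xi>]
  have "norm (cond_payoff r \<xi> s) \<le> real CARD('a)" for s
  proof -
    have "norm (cond_payoff r \<xi> s) \<le> (\<Sum>j\<in>UNIV. \<bar>cond_payoff r \<xi> s $ j\<bar>)"
      by (rule norm_le_l1_cart)
    also have "\<dots> \<le> (\<Sum>j\<in>(UNIV::'a set). 1)"
      \<comment> \<open>With \<open>T = 0\<close> the tail is the whole payoff and the bound is
        1.\<close>
      using cond_payoff_tail[OF \<xi> r, of s _ 0] by (intro sum_mono) simp
    finally show ?thesis by simp
  qed
  then have int: "integrable signals (cond_payoff r \<xi>)"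
    by (intro integrable_const_bound[of _ "real CARD('a)"]) auto
  then have nth: "payoff r \<xi> $ i = (\<integral>s. cond_payoff r \<xi> s $ i \<partial>signals)"
    unfolding payoff_def by (rule integral_bounded_linear[OF bounded_linear_vec_nth, symmetric])
  have int_nth: "integrable signals (\<lambda>s. cond_payoff r \<xi> s $ i)"
    by (rule integrable_bounded_linear[OF bounded_linear_vec_nth int])
  have int_C: "integrable signals (cont_prob \<xi> t)" for t
    using cont_prob_nonneg[OF \<xi>] cont_prob_le_1[OF \<xi>] by (intro integrable_const_bound[of _ 1]) auto
  have int_sum: "integrable signals (\<lambda>s. \<Sum>t<T. stage_payoff r \<xi> i t s)"
    using abs_stage_payoff_le[OF \<xi> r] int_C
    by (intro Bochner_Integration.integrable_sum Bochner_Integration.integrable_bound[OF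
        Bochner_Integration.integrable_diff[OF int_C int_C]])
      (auto intro!: order.trans[OF _ abs_ge_self])
  have "payoff r \<xi> $ i - (\<integral>s. (\<Sum>t<T. stage_payoff r \<xi> i t s) \<partial>signals)
      = (\<integral>s. (cond_payoff r \<xi> s $ i - (\<Sum>t<T. stage_payoff r \<xi> i t s)) \<partial>signals)"
    using int_nth int_sum by (simp add: nth)
  also have "\<bar>\<dots>\<bar> \<le> (\<integral>s. \<bar>cond_payoff r \<xi> s $ i - (\<Sum>t<T. stage_payoff r \<xi> i t s)\<bar> \<partial>signals)"
    by (rule integral_abs_bound)
  also have "\<dots> \<le> (\<integral>s. cont_prob \<xi> T s \<partial>signals)"
    using cond_payoff_tail[OF \<xi> r] int_nth int_sum int_C by (intro integral_mono) auto
  finally show ?thesis .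
qed

subsection \<open>Profiles driven by a Markov chain\<close>

lemma integrable_signals_mult:
  fixes F G :: "(nat \<Rightarrow> real) \<Rightarrow> real"
  assumes "F \<in> borel_measurable signals" "\<And>s. 0 \<le> F s" "\<And>s. F s \<le> 1"
    and "G \<in> borel_measurable signals" "\<And>s. 0 \<le> G s" "\<And>s. G s \<le> 1"
  shows "integrable signals (\<lambda>s. F s * G s)"
proof -
  interpret prob_space signals by (rule prob_space_signals)
  have "\<bar>F s * G s\<bar> \<le> 1" for s
    unfolding abs_mult using assms by (intro mult_le_one) auto
  moreover have "(\<lambda>s. F s * G s) \<in> borel_measurable signals"
    using assms by (intro borel_measurable_times)
  ultimately show ?thesis
    by (intro integrable_const_bound[of _ 1]) auto
qed

text \<open>
  The states of the chain carry the target payoffs \<open>v\<close>. The tolerance \<open>\<rho>\<close> in \<open>balance\<close> pays for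
  \<open>leave\<close>, which prevents the designated quitter from blocking the game.
\<close>
locale sunspot_chain =
  fixes r :: "'n::finite set \<Rightarrow> real^'n" and J :: "'k::finite \<Rightarrow> 'n" and v :: "'k \<Rightarrow> real^'n"
    and P :: "'k \<Rightarrow> 'k \<Rightarrow> real" and \<beta> :: "'k \<Rightarrow> real" and \<mu> \<rho> :: real
    and start :: "real \<Rightarrow> 'k" and step :: "'k \<Rightarrow> real \<Rightarrow> 'k"
  assumes game: "quitting_game r" and solo: "\<And>i. r {i} $ i = 0"
    and v_nonneg: "\<And>k i. 0 \<le> v k $ i" and v_le_1: "\<And>k i. v k $ i \<le> 1"
    and P_nonneg: "\<And>k l. 0 \<le> P k l" and P_sum: "\<And>k. (\<Sum>l\<in>UNIV. P k l) = 1"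
    and mu: "0 < \<mu>" "\<mu> < 1" and rho: "0 < \<rho>" "\<rho> \<le> 1"
    and start_measurable: "start \<in> borel \<rightarrow>\<^sub>M count_space UNIV"
    and start_law: "\<And>f :: 'k \<Rightarrow> real. (\<integral>u. f (start u) \<partial>unit_uniform) = (\<Sum>l\<in>UNIV. \<beta> l * f l)"
    and step_measurable: "\<And>k. step k \<in> borel \<rightarrow>\<^sub>M count_space UNIV"
    and step_law: "\<And>k. \<And>f :: 'k \<Rightarrow> real.
      (\<integral>u. f (step k u) \<partial>unit_uniform) = (\<Sum>l\<in>UNIV. P k l * f l)"
    and balance: "\<And>k i. \<bar>\<mu> * r {J k} $ i + (1 - \<mu>) * (\<Sum>l\<in>UNIV. P k l * v l $ i) - v k $ i\<bar> \<le> \<rho>"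
    and balance_quitter: "\<And>k. (\<Sum>l\<in>UNIV. P k l * v l $ J k) = 0"
    and leave: "\<And>k. \<rho> \<le> (\<Sum>l | J l \<noteq> J k. P k l)"
begin

primrec state :: "nat \<Rightarrow> (nat \<Rightarrow> real) \<Rightarrow> 'k" where
  "state 0 s = start (s 0)"
| "state (Suc t) s = step (state t s) (s (Suc t))"

definition profile :: "'n \<Rightarrow> nat \<Rightarrow> (nat \<Rightarrow> real) \<Rightarrow> real" where
  "profile i t s = (if J (state t s) = i then \<mu> else 0)"

lemma measurable_state [measurable]: "state t \<in> signals \<rightarrow>\<^sub>M count_space UNIV"
proof (induction t)
  case 0
  have "state 0 = (\<lambda>s. start (s 0))" by auto
  then show ?case
    using measurable_compose[OF measurable_signal start_measurable] by simp
next
  case (Suc t)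
  have "state (Suc t) = (\<lambda>s. step (state t s) (s (Suc t)))" by auto
  moreover have "(\<lambda>s. step (state t s) (s (Suc t))) \<in> signals \<rightarrow>\<^sub>M count_space UNIV"
    by (rule measurable_compose_countable'[where f="\<lambda>k s. step k (s (Suc t))" and g="state t", OF _ Suc])
      (auto intro: measurable_compose[OF measurable_signal step_measurable] countable_finite)
  ultimately show ?case by simp
qed

lemma measurable_of_state: "(\<lambda>s. f (state t s)) \<in> borel_measurable signals" for f :: "'k \<Rightarrow> real"
  using measurable_state by (rule measurable_compose) simp

lemma depends_upto_state: "depends_upto t (state t)"
proof (induction t)
  case (Suc t)
  then have "state t s = state t s'" if "\<forall>k\<le>Suc t. s k = s' k" for s s'
    using that by (simp add: depends_upto_def)
  then show ?case
    unfolding depends_upto_def state.simps by (metis order_refl)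
qed (simp add: depends_upto_def)

lemma sunspot_profile_profile: "sunspot_profile profile"
proof -
  have "profile i t \<in> borel_measurable signals" for i t
    unfolding profile_def[abs_def] by measurable
  moreover have "profile i t s = profile i t s'" if "\<forall>k\<le>t. s k = s' k" for i t s s'
    using depends_upto_state[of t] that unfolding depends_upto_def profile_def by metis
  ultimately show ?thesis
    using mu by (auto simp: sunspot_profile_def sunspot_strategy_def profile_def)
qed

lemma sunspot_profile_deviation:
  "sunspot_strategy \<eta> \<Longrightarrow> sunspot_profile (profile(m := \<eta>))"
  using sunspot_profile_profile by (simp add: sunspot_profile_def)

text \<open>The Markov property in integrated form. Cutting \<open>F\<close> into pieces
  \<open>Fk\<close>, each living on one current state, turns the next state into a function of the
  fresh signal alone.\<close>

lemma integral_next_state: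
  fixes F :: "(nat \<Rightarrow> real) \<Rightarrow> real" and f :: "'k \<Rightarrow> real"
  assumes F: "F \<in> borel_measurable signals" "depends_upto t F" "\<And>s. \<bar>F s\<bar> \<le> B"
  shows "(\<integral>s. F s * f (state (Suc t) s) \<partial>signals)
    = (\<integral>s. F s * (\<Sum>l\<in>UNIV. P (state t s) l * f l) \<partial>signals)"
proof -
  interpret prob_space signals by (rule prob_space_signals)
  note [measurable] = F(1)
  define Fk where "Fk k s = (if state t s = k then F s else 0)" for k s
  have Fk_meas [measurable]: "Fk k \<in> borel_measurable signals" for k
    unfolding Fk_def[abs_def] by measurable
  have B: "0 \<le> B" using F(3)[of undefined] by linarith
  have Fk_le: "\<bar>Fk k s\<bar> \<le> B" for k s
    using F(3) B by (simp add: Fk_def)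
  have Fk_dep: "depends_upto t (Fk k)" for k
    using F(2) depends_upto_state[of t] unfolding depends_upto_def Fk_def by metis
  have int_Fk: "integrable signals (Fk k)" for k
    using Fk_le by (intro integrable_const_bound[of _ B]) auto
  have f_le: "\<bar>f k\<bar> \<le> (\<Sum>k\<in>UNIV. \<bar>f k\<bar>)" for k
    by (rule member_le_sum) auto
  have G_meas: "(\<lambda>u. f (step k u)) \<in> borel_measurable borel" for k
    using step_measurable by (rule measurable_compose) simp
  have int_FG: "integrable signals (\<lambda>s. Fk k s * f (step k (s (Suc t))))" for k
  proof (intro integrable_const_bound[of _ "B * (\<Sum>k\<in>UNIV. \<bar>f k\<bar>)"])
    show "AE s in signals. norm (Fk k s * f (step k (s (Suc t)))) \<le> B * (\<Sum>k\<in>UNIV. \<bar>f k\<bar>)"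
      using Fk_le f_le B by (auto simp: abs_mult intro!: mult_mono)
    show "(\<lambda>s. Fk k s * f (step k (s (Suc t)))) \<in> borel_measurable signals"
      using measurable_compose[OF measurable_signal G_meas] by measurable
  qed
  have "(\<integral>s. F s * f (state (Suc t) s) \<partial>signals)
      = (\<integral>s. (\<Sum>k\<in>UNIV. Fk k s * f (step k (s (Suc t)))) \<partial>signals)"
    by (simp add: Fk_def if_distrib[of "\<lambda>x. x * _"] cong: if_cong)
  also have "\<dots> = (\<Sum>k\<in>UNIV. \<integral>s. Fk k s * f (step k (s (Suc t))) \<partial>signals)"
    by (intro Bochner_Integration.integral_sum int_FG)
  also have "\<dots> = (\<Sum>k\<in>UNIV. \<integral>s. Fk k s * (\<Sum>l\<in>UNIV. P k l * f l) \<partial>signals)"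
    using integral_signals_mult_next[OF Fk_meas Fk_dep Fk_le G_meas f_le] by (simp add: step_law)
  also have "\<dots> = (\<integral>s. (\<Sum>k\<in>UNIV. Fk k s * (\<Sum>l\<in>UNIV. P k l * f l)) \<partial>signals)"
    using int_Fk by (intro Bochner_Integration.integral_sum[symmetric]) simp
  also have "\<dots> = (\<integral>s. F s * (\<Sum>l\<in>UNIV. P (state t s) l * f l) \<partial>signals)"
    by (simp add: Fk_def if_distrib[of "\<lambda>x. x * _"] cong: if_cong)
  finally show ?thesis .
qed

lemma integral_initial_state: "(\<integral>s. f (state 0 s) \<partial>signals) = (\<Sum>l\<in>UNIV. \<beta> l * f l)"
  for f :: "'k \<Rightarrow> real"
proof -
  have "(\<lambda>u. f (start u)) \<in> borel_measurable borel"
    using start_measurable by (rule measurable_compose) simp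
  then show ?thesis
    using integral_signal[of "\<lambda>u. f (start u)" 0] start_law by simp
qed

end

section \<open>Stages at which at most two players may quit\<close>

lemma stage_payoff_restrict:
  assumes "\<And>i. i \<notin> A \<Longrightarrow> \<xi> i t s = 0"
  shows "stage_payoff r \<xi> i t s = cont_prob \<xi> t s *
    (\<Sum>S\<in>Pow A - {{}}. (\<Prod>i\<in>S. \<xi> i t s) * (\<Prod>i\<in>A - S. 1 - \<xi> i t s) * r S $ i)"
proof -
  have "stage_payoff r \<xi> i t s = (\<Sum>S\<in>Pow A - {{}}. quit_prob \<xi> t S s * r S $ i)"
    unfolding stage_payoff_def
  proof (rule sum.mono_neutral_right)
    show "\<forall>S\<in>UNIV - {{}} - (Pow A - {{}}). quit_prob \<xi> t S s * r S $ i = 0"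
    proof
      fix S assume "S \<in> UNIV - {{}} - (Pow A - {{}})"
      then have "\<exists>i\<in>S. \<xi> i t s = 0" using assms by blast
      then have "(\<Prod>i\<in>S. \<xi> i t s) = 0" by simp
      then show "quit_prob \<xi> t S s * r S $ i = 0" by (simp add: quit_prob_def)
    qed
  qed auto
  also have "\<dots> = (\<Sum>S\<in>Pow A - {{}}. cont_prob \<xi> t s *
      ((\<Prod>i\<in>S. \<xi> i t s) * (\<Prod>i\<in>A - S. 1 - \<xi> i t s) * r S $ i))"
  proof (intro sum.cong refl)
    fix S assume "S \<in> Pow A - {{}}"
    have "(\<Prod>i\<in>UNIV - S. 1 - \<xi> i t s) = (\<Prod>i\<in>A - S. 1 - \<xi> i t s)"
      using assms by (intro prod.mono_neutral_right) auto
    then show "quit_prob \<xi> t S s * r S $ i = cont_prob \<xi> t s *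
      ((\<Prod>i\<in>S. \<xi> i t s) * (\<Prod>i\<in>A - S. 1 - \<xi> i t s) * r S $ i)"
      by (simp add: quit_prob_def)
  qed
  finally show ?thesis by (simp add: sum_distrib_left)
qed

lemma cont_prob_Suc_restrict:
  assumes "\<And>i. i \<notin> A \<Longrightarrow> \<xi> i t s = 0"
  shows "cont_prob \<xi> (Suc t) s = cont_prob \<xi> t s * (\<Prod>i\<in>A. 1 - \<xi> i t s)"
proof -
  have "(\<Prod>i\<in>UNIV. 1 - \<xi> i t s) = (\<Prod>i\<in>A. 1 - \<xi> i t s)"
    using assms by (intro prod.mono_neutral_right) auto
  then show ?thesis by (simp add: cont_prob_Suc)
qed

lemma stage_payoff_single:
  assumes "\<And>i. i \<noteq> j \<Longrightarrow> \<xi> i t s = 0"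
  shows "stage_payoff r \<xi> i t s = cont_prob \<xi> t s * (\<xi> j t s * r {j} $ i)"
    and "cont_prob \<xi> (Suc t) s = cont_prob \<xi> t s * (1 - \<xi> j t s)"
proof -
  have "Pow {j} - {{}} = {{j}}" by auto
  with stage_payoff_restrict[of "{j}" \<xi> t s r i] assms
  show "stage_payoff r \<xi> i t s = cont_prob \<xi> t s * (\<xi> j t s * r {j} $ i)"
    by simp
  show "cont_prob \<xi> (Suc t) s = cont_prob \<xi> t s * (1 - \<xi> j t s)"
    using cont_prob_Suc_restrict[of "{j}" \<xi> t s] assms by simp
qed

text \<open>Serves a deviation of \<open>m\<close> at a stage where \<open>j\<close> is designated
  to quit; no third player then quits.\<close>

lemma stage_payoff_pair:
  assumes "j \<noteq> m" "\<And>i. i \<noteq> j \<Longrightarrow> i \<noteq> m \<Longrightarrow> \<xi> i t s = 0"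
  shows "stage_payoff r \<xi> i t s = cont_prob \<xi> t s *
      (\<xi> j t s * (1 - \<xi> m t s) * r {j} $ i + \<xi> m t s * (1 - \<xi> j t s) * r {m} $ i
        + \<xi> j t s * \<xi> m t s * r {j, m} $ i)"
    and "cont_prob \<xi> (Suc t) s = cont_prob \<xi> t s * ((1 - \<xi> j t s) * (1 - \<xi> m t s))"
proof -
  have "Pow {j, m} - {{}} = {{j}, {m}, {j, m}}" by auto
  moreover have "{j, m} - {j} = {m}" "{j, m} - {m} = {j}" "{j} \<noteq> {j, m}" "{m} \<noteq> {j, m}"
    using assms(1) by auto
  ultimately show "stage_payoff r \<xi> i t s = cont_prob \<xi> t s *
      (\<xi> j t s * (1 - \<xi> m t s) * r {j} $ i + \<xi> m t s * (1 - \<xi> j t s) * r {m} $ i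
        + \<xi> j t s * \<xi> m t s * r {j, m} $ i)"
    using stage_payoff_restrict[of "{j, m}" \<xi> t s r i] assms by simp
  show "cont_prob \<xi> (Suc t) s = cont_prob \<xi> t s * ((1 - \<xi> j t s) * (1 - \<xi> m t s))"
    using cont_prob_Suc_restrict[of "{j, m}" \<xi> t s] assms by simp
qed

section \<open>Drift, absorption and payoff bounds for the chain\<close>

context sunspot_chain
begin

abbreviation expected_next :: "'n \<Rightarrow> 'k \<Rightarrow> real" where
  "expected_next i k \<equiv> \<Sum>l\<in>UNIV. P k l * v l $ i"

text \<open>Accumulated payoff plus \<open>cont_prob * v\<close> is a supermartingale up to an error
  charged to the mass absorbed at the stage, so that all errors add up to at most
  \<open>\<rho> / \<mu> + \<mu>\<close>. If \<open>m\<close> is the designated quitter, quitting and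
  continuing are both worth 0 to her. Otherwise the absorbed fraction is
  \<open>\<mu> + q * (1 - \<mu>)\<close>: it is at least \<open>\<mu>\<close>, which pays for the
  imbalance \<open>\<rho>\<close>, and at least \<open>q\<close>, which pays for the gain
  \<open>\<mu> * q\<close> from joint quitting.\<close>

lemma deviation_drift:
  fixes m :: 'n
  assumes \<eta>: "sunspot_strategy \<eta>"
  defines "\<xi> \<equiv> profile(m := \<eta>)"
  shows "stage_payoff r \<xi> m t s + cont_prob \<xi> (Suc t) s * expected_next m (state t s)
    \<le> cont_prob \<xi> t s * v (state t s) $ m
      + (\<rho> / \<mu> + \<mu>) * (cont_prob \<xi> t s - cont_prob \<xi> (Suc t) s)"
proof -
  let ?k = "state t s"
  define j where "j = J ?k"
  define c where "c = cont_prob \<xi> t s"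
  define q where "q = \<xi> m t s"
  have \<xi>: "sunspot_profile \<xi>"
    unfolding \<xi>_def using \<eta> by (rule sunspot_profile_deviation)
  have c: "0 \<le> c" and q: "0 \<le> q" "q \<le> 1"
    using cont_prob_nonneg[OF \<xi>] sunspot_profileD[OF \<xi>] by (auto simp: c_def q_def)
  show ?thesis
  proof (cases "j = m")
    case True
    have "\<xi> i t s = 0" if "i \<noteq> m" for i
      using True that by (auto simp: \<xi>_def profile_def j_def)
    note stage_payoff_single(1)[where \<xi>=\<xi>, OF this, where r=r and i=m]
    then have "stage_payoff r \<xi> m t s = 0"
      by (simp add: solo)
    moreover have "expected_next m ?k = 0"
      using balance_quitter[of ?k] True by (simp add: j_def)
    moreover have "0 \<le> (\<rho> / \<mu> + \<mu>) * (cont_prob \<xi> t s - cont_prob \<xi> (Suc t) s)"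
      using mu rho cont_prob_Suc_le[OF \<xi>, of t s] by (intro mult_nonneg_nonneg) auto
    ultimately show ?thesis
      using v_nonneg c by (simp add: c_def)
  next
    case False
    have zero: "\<xi> i t s = 0" if "i \<noteq> j" "i \<noteq> m" for i
      using that by (auto simp: \<xi>_def profile_def j_def)
    have \<xi>_j: "\<xi> j t s = \<mu>"
      using False by (simp add: \<xi>_def profile_def j_def)
    let ?V = "v ?k $ m" and ?W = "expected_next m ?k"
    have stage: "stage_payoff r \<xi> m t s = c * (\<mu> * (1 - q) * r {j} $ m + \<mu> * q * r {j, m} $ m)"
      and cont: "cont_prob \<xi> (Suc t) s = c * ((1 - \<mu>) * (1 - q))"
      using stage_payoff_pair(1)[where \<xi>=\<xi>, OF False zero, where r=r and i=m]
        stage_payoff_pair(2)[where \<xi>=\<xi>, OF False zero] by (simp_all add: \<xi>_j q_def c_def solo)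
    have "(1 - q) * (\<mu> * r {j} $ m + (1 - \<mu>) * ?W) \<le> (1 - q) * (?V + \<rho>)"
      using balance[of ?k m] q by (intro mult_left_mono) (auto simp: j_def)
    moreover have "\<mu> * q * r {j, m} $ m \<le> \<mu> * q"
      using abs_payoff_le_1[OF game, of "{j, m}" m] mu q by (intro mult_left_le) auto
    \<comment> \<open>Quitting alone gives \<open>m\<close> only 0, which is no better than
      \<open>?V\<close>.\<close>
    moreover have "0 \<le> q * ?V" "0 \<le> q * \<rho>"
      using q v_nonneg rho by auto
    moreover have "\<rho> + \<mu> * q \<le> (\<rho> / \<mu> + \<mu>) * (\<mu> + q * (1 - \<mu>))"
    proof -
      have "(\<rho> / \<mu> + \<mu>) * (\<mu> + q * (1 - \<mu>))
          = \<rho> + \<mu> * q + (\<rho> / \<mu>) * (q * (1 - \<mu>)) + \<mu> * (\<mu> * (1 - q))"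
        using mu by (simp add: field_simps)
      moreover have "0 \<le> (\<rho> / \<mu>) * (q * (1 - \<mu>))" "0 \<le> \<mu> * (\<mu> * (1 - q))"
        using mu rho q by auto
      ultimately show ?thesis by linarith
    qed
    ultimately have "(1 - q) * (\<mu> * r {j} $ m + (1 - \<mu>) * ?W) + \<mu> * q * r {j, m} $ m
        \<le> ?V + (\<rho> / \<mu> + \<mu>) * (\<mu> + q * (1 - \<mu>))"
      by (simp add: algebra_simps)
    then have "c * ((1 - q) * (\<mu> * r {j} $ m + (1 - \<mu>) * ?W) + \<mu> * q * r {j, m} $ m)
        \<le> c * (?V + (\<rho> / \<mu> + \<mu>) * (\<mu> + q * (1 - \<mu>)))"
      using c by (rule mult_left_mono)
    moreover define e where "e = \<rho> / \<mu> + \<mu>"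
    ultimately show ?thesis
      unfolding stage cont c_def[symmetric] e_def[symmetric] by (simp add: algebra_simps)
  qed
qed

text \<open>Without a deviator exactly the fraction \<open>\<mu>\<close> is absorbed at each stage,
  so the imbalance \<open>\<rho>\<close> is \<open>\<rho> / \<mu>\<close> times the absorbed
  mass.\<close>

lemma profile_drift:
  "stage_payoff r profile i t s + cont_prob profile (Suc t) s * expected_next i (state t s)
    \<ge> cont_prob profile t s * v (state t s) $ i
      - \<rho> / \<mu> * (cont_prob profile t s - cont_prob profile (Suc t) s)"
proof -
  let ?k = "state t s" and ?c = "cont_prob profile t s"
  have zero: "profile i t s = 0" if "i \<noteq> J ?k" for i
    using that by (simp add: profile_def)
  have q: "profile (J ?k) t s = \<mu>"
    by (simp add: profile_def)
  have stage: "stage_payoff r profile i t s = ?c * (\<mu> * r {J ?k} $ i)"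
    and cont: "cont_prob profile (Suc t) s = ?c * (1 - \<mu>)"
    using stage_payoff_single(1)[where \<xi>=profile, OF zero, where r=r and i=i]
      stage_payoff_single(2)[where \<xi>=profile, OF zero] q by simp_all
  have "?c * (\<mu> * r {J ?k} $ i + (1 - \<mu>) * expected_next i ?k) \<ge> ?c * (v ?k $ i - \<rho>)"
    using balance[of ?k i] cont_prob_nonneg[OF sunspot_profile_profile]
    by (intro mult_left_mono) auto
  then show ?thesis
    unfolding stage cont using mu by (simp add: algebra_simps)
qed

text \<open>No single player can keep the game going: by \<open>leave\<close>, in any two successive
  stages someone other than \<open>m\<close> is designated at least once with probability at least
  \<open>\<rho>\<close>, and she quits with probability \<open>\<mu>\<close>. Expected survival
  therefore contracts by \<open>1 - \<mu> * \<rho>\<close> every two stages.\<close>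

lemma absorption:
  assumes \<eta>: "sunspot_strategy \<eta>"
  shows "(\<lambda>t. \<integral>s. cont_prob (profile(m := \<eta>)) t s \<partial>signals) \<longlonglongrightarrow> 0"
proof -
  interpret prob_space signals by (rule prob_space_signals)
  define \<xi> where "\<xi> = profile(m := \<eta>)"
  have \<xi>: "sunspot_profile \<xi>"
    unfolding \<xi>_def using \<eta> by (rule sunspot_profile_deviation)
  note [measurable] = measurable_cont_prob[OF \<xi>]
  let ?c = "\<lambda>t. \<integral>s. cont_prob \<xi> t s \<partial>signals"
  have C: "0 \<le> cont_prob \<xi> t s" "cont_prob \<xi> t s \<le> 1" for t s
    using cont_prob_nonneg[OF \<xi>] cont_prob_le_1[OF \<xi>] by auto
  have int_C: "integrable signals (cont_prob \<xi> t)" for t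
    using C by (intro integrable_const_bound[of _ 1]) auto
  \<comment> \<open>An upper bound on survival of one stage in state \<open>l\<close>: when
    \<open>m\<close> herself is designated, she may decline to quit.\<close>
  define f where "f l = (if J l = m then 1 else 1 - \<mu>)" for l
  have f: "0 \<le> f l" "f l \<le> 1" for l
    using mu by (auto simp: f_def)
  have step_le: "cont_prob \<xi> (Suc t) s \<le> cont_prob \<xi> t s * f (state t s)" for t s
  proof (cases "J (state t s) = m")
    case True
    then show ?thesis using cont_prob_Suc_le[OF \<xi>] by (simp add: f_def)
  next
    case False
    have "\<xi> i t s = 0" if "i \<noteq> J (state t s)" "i \<noteq> m" for i
      using that by (auto simp: \<xi>_def profile_def)
    note stage_payoff_pair(2)[where \<xi>=\<xi>, OF False this]
    moreover have "\<xi> (J (state t s)) t s = \<mu>"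
      using False by (simp add: \<xi>_def profile_def)
    moreover have "(1 - \<mu>) * (1 - \<xi> m t s) \<le> 1 - \<mu>"
      using sunspot_profileD[OF \<xi>] mu by (intro mult_left_le) auto
    ultimately show ?thesis
      using False C(1) by (auto simp: f_def intro!: mult_left_mono)
  qed
  \<comment> \<open>The same bound one stage ahead, averaged over the next state;
    \<open>f k * g k\<close> then bounds survival of two stages from \<open>k\<close>.\<close>
  define g where "g k = (\<Sum>l\<in>UNIV. P k l * f l)" for k
  have g: "0 \<le> g k" "g k \<le> 1" for k
  proof -
    show "0 \<le> g k" using P_nonneg f by (auto simp: g_def intro!: sum_nonneg)
    have "g k \<le> (\<Sum>l\<in>UNIV. P k l)"
      unfolding g_def using P_nonneg f by (intro sum_mono) (auto intro: mult_left_le)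
    then show "g k \<le> 1" using P_sum by simp
  qed
  have fg: "f k * g k \<le> 1 - \<mu> * \<rho>" for k
  proof (cases "J k = m")
    case True
    have "g k = (\<Sum>l\<in>UNIV. P k l - (if J l \<noteq> m then \<mu> * P k l else 0))"
      unfolding g_def f_def by (intro sum.cong) (auto simp: algebra_simps)
    also have "\<dots> = 1 - \<mu> * (\<Sum>l | J l \<noteq> m. P k l)"
      by (simp add: sum_subtractf P_sum sum.If_cases sum_distrib_left)
    also have "\<dots> \<le> 1 - \<mu> * \<rho>"
      using leave[of k] True mu by simp
    finally show ?thesis using True by (simp add: f_def)
  next
    case False
    have "f k * g k \<le> f k" using f g by (intro mult_left_le)
    also have "\<dots> \<le> 1 - \<mu> * \<rho>" using False mu rho by (simp add: f_def mult_left_le)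
    finally show ?thesis .
  qed
  have two_steps: "?c (Suc (Suc t)) \<le> (1 - \<mu> * \<rho>) * ?c t" for t
  proof -
    have "?c (Suc (Suc t)) \<le> (\<integral>s. cont_prob \<xi> (Suc t) s * f (state (Suc t) s) \<partial>signals)"
    proof (rule integral_mono[OF int_C _ step_le])
      show "integrable signals (\<lambda>s. cont_prob \<xi> (Suc t) s * f (state (Suc t) s))"
        by (intro integrable_signals_mult measurable_cont_prob[OF \<xi>] measurable_of_state C f)
    qed
    also have "\<dots> = (\<integral>s. cont_prob \<xi> (Suc t) s * g (state t s) \<partial>signals)"
      unfolding g_def
      using C by (intro integral_next_state[where B=1] measurable_cont_prob[OF \<xi>] depends_upto_cont_prob[OF \<xi>]) auto
    also have "\<dots> \<le> (\<integral>s. (1 - \<mu> * \<rho>) * cont_prob \<xi> t s \<partial>signals)"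
    proof (rule integral_mono)
      show "integrable signals (\<lambda>s. cont_prob \<xi> (Suc t) s * g (state t s))"
        by (intro integrable_signals_mult measurable_cont_prob[OF \<xi>] measurable_of_state C g)
      show "integrable signals (\<lambda>s. (1 - \<mu> * \<rho>) * cont_prob \<xi> t s)"
        using int_C by simp
      fix s
      have "cont_prob \<xi> (Suc t) s * g (state t s) \<le> cont_prob \<xi> t s * (f (state t s) * g (state t s))"
        using mult_right_mono[OF step_le g(1)] by (simp add: mult.assoc)
      also have "\<dots> \<le> cont_prob \<xi> t s * (1 - \<mu> * \<rho>)"
        using fg C by (intro mult_left_mono)
      finally show "cont_prob \<xi> (Suc t) s * g (state t s) \<le> (1 - \<mu> * \<rho>) * cont_prob \<xi> t s"
        by (simp add: mult.commute)
    qed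
    finally show ?thesis by simp
  qed
  have "decseq ?c"
    using cont_prob_Suc_le[OF \<xi>] int_C by (intro decseq_SucI integral_mono) auto
  moreover have nonneg: "0 \<le> ?c t" for t
    using C by (intro integral_nonneg_AE) auto
  ultimately obtain L where L: "?c \<longlonglongrightarrow> L"
    by (metis decseq_convergent)
  have "(1 - \<mu> * \<rho>) * L \<ge> L"
  proof (rule LIMSEQ_le)
    show "(\<lambda>t. ?c (Suc (Suc t))) \<longlonglongrightarrow> L"
      using L by (intro LIMSEQ_Suc)
    show "(\<lambda>t. (1 - \<mu> * \<rho>) * ?c t) \<longlonglongrightarrow> (1 - \<mu> * \<rho>) * L"
      using L by (rule tendsto_mult_left)
    show "\<exists>N. \<forall>t\<ge>N. ?c (Suc (Suc t)) \<le> (1 - \<mu> * \<rho>) * ?c t"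
      using two_steps by blast
  qed
  then have "\<mu> * \<rho> * L \<le> 0"
    by (simp add: left_diff_distrib)
  then have "L \<le> 0"
    using mu rho by (auto simp: mult_le_0_iff)
  moreover have "0 \<le> L"
    using L nonneg by (intro LIMSEQ_le_const[OF L]) blast
  ultimately have "L = 0" by simp
  with L show ?thesis by (simp add: \<xi>_def)
qed

text \<open>The conditional mean, given the signals up to \<open>t\<close>, of the increment of
  accumulated payoff plus \<open>cont_prob * v\<close>. In this form it can be bounded
  pointwise.\<close>

definition drift :: "('n \<Rightarrow> nat \<Rightarrow> (nat \<Rightarrow> real) \<Rightarrow> real) \<Rightarrow> 'n \<Rightarrow> nat \<Rightarrow> (nat \<Rightarrow> real) \<Rightarrow> real" where
  "drift \<xi> i t s = stage_payoff r \<xi> i t s + cont_prob \<xi> (Suc t) s * expected_next i (state t s)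
    - cont_prob \<xi> t s * v (state t s) $ i"

lemma integrable_drift:
  assumes \<xi>: "sunspot_profile \<xi>"
  shows "integrable signals (stage_payoff r \<xi> i t)"
    and "integrable signals (cont_prob \<xi> t)"
    and "integrable signals (\<lambda>s. cont_prob \<xi> t s * v (state t s) $ i)"
    and "integrable signals (\<lambda>s. cont_prob \<xi> (Suc t) s * expected_next i (state t s))"
    and "integrable signals (drift \<xi> i t)"
proof -
  interpret prob_space signals by (rule prob_space_signals)
  note [measurable] = measurable_cont_prob[OF \<xi>] measurable_stage_payoff[OF \<xi>]
  have C: "0 \<le> cont_prob \<xi> t s" "cont_prob \<xi> t s \<le> 1" for t s
    using cont_prob_nonneg[OF \<xi>] cont_prob_le_1[OF \<xi>] by auto
  have A: "\<bar>stage_payoff r \<xi> i t s\<bar> \<le> 1" for t s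
    using abs_stage_payoff_le[OF \<xi> game, of i t s] C[of t s] C[of "Suc t" s] by linarith
  have W: "0 \<le> expected_next i k" "expected_next i k \<le> 1" for k
  proof -
    show "0 \<le> expected_next i k" using P_nonneg v_nonneg by (auto intro!: sum_nonneg)
    have "expected_next i k \<le> (\<Sum>l\<in>UNIV. P k l)"
      using P_nonneg v_le_1 by (intro sum_mono) (auto intro: mult_left_le)
    then show "expected_next i k \<le> 1" using P_sum by simp
  qed
  show int_A: "integrable signals (stage_payoff r \<xi> i t)"
    using A by (intro integrable_const_bound[of _ 1]) auto
  show "integrable signals (cont_prob \<xi> t)"
    using C by (intro integrable_const_bound[of _ 1]) auto
  show int_V: "integrable signals (\<lambda>s. cont_prob \<xi> t s * v (state t s) $ i)"
    by (intro integrable_signals_mult measurable_cont_prob[OF \<xi>] measurable_of_state C v_nonneg v_le_1)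
  show int_W: "integrable signals (\<lambda>s. cont_prob \<xi> (Suc t) s * expected_next i (state t s))"
    by (intro integrable_signals_mult measurable_cont_prob[OF \<xi>] measurable_of_state C W)
  show "integrable signals (drift \<xi> i t)"
    unfolding drift_def[abs_def] using int_A int_V int_W by simp
qed

text \<open>The terms \<open>cont_prob * v\<close> telescope in expectation, because
  \<open>integral_next_state\<close> trades \<open>expected_next\<close> for the value at the actual
  next state.\<close>

lemma integral_drift_sum:
  assumes \<xi>: "sunspot_profile \<xi>"
  shows "(\<integral>s. (\<Sum>t<T. drift \<xi> i t s) \<partial>signals)
    = (\<integral>s. (\<Sum>t<T. stage_payoff r \<xi> i t s) \<partial>signals)
      + (\<integral>s. cont_prob \<xi> T s * v (state T s) $ i \<partial>signals) - (\<Sum>l\<in>UNIV. \<beta> l * v l $ i)"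
proof (induction T)
  case 0
  show ?case using integral_initial_state[of "\<lambda>k. v k $ i"] by simp
next
  case (Suc T)
  have "(\<integral>s. cont_prob \<xi> (Suc T) s * expected_next i (state T s) \<partial>signals)
      = (\<integral>s. cont_prob \<xi> (Suc T) s * v (state (Suc T) s) $ i \<partial>signals)"
    using cont_prob_nonneg[OF \<xi>] cont_prob_le_1[OF \<xi>]
    by (intro integral_next_state[where B=1, symmetric] depends_upto_cont_prob[OF \<xi>]
        measurable_cont_prob[OF \<xi>]) auto
  moreover have "(\<integral>s. drift \<xi> i T s \<partial>signals) = (\<integral>s. stage_payoff r \<xi> i T s \<partial>signals)
      + (\<integral>s. cont_prob \<xi> (Suc T) s * expected_next i (state T s) \<partial>signals)
      - (\<integral>s. cont_prob \<xi> T s * v (state T s) $ i \<partial>signals)"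
    unfolding drift_def[abs_def] using integrable_drift(1,3,4)[OF \<xi>] by simp
  ultimately show ?case
    using Suc integrable_drift[OF \<xi>] by (simp del: state.simps)
qed

lemma payoff_deviation_le:
  assumes \<eta>: "sunspot_strategy \<eta>"
  shows "payoff r (profile(m := \<eta>)) $ m \<le> (\<Sum>l\<in>UNIV. \<beta> l * v l $ m) + (\<rho> / \<mu> + \<mu>)"
proof -
  interpret prob_space signals by (rule prob_space_signals)
  define \<xi> where "\<xi> = profile(m := \<eta>)"
  have \<xi>: "sunspot_profile \<xi>"
    unfolding \<xi>_def using \<eta> by (rule sunspot_profile_deviation)
  let ?x = "\<Sum>l\<in>UNIV. \<beta> l * v l $ m" and ?e = "\<rho> / \<mu> + \<mu>"
  have "payoff r \<xi> $ m \<le> ?x + ?e + (\<integral>s. cont_prob \<xi> T s \<partial>signals)" for T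
  proof -
    have "(\<Sum>t<T. drift \<xi> m t s) \<le> ?e" for s
    proof -
      have "(\<Sum>t<T. drift \<xi> m t s)
        \<le> (\<Sum>t<T. ?e * (cont_prob \<xi> t s - cont_prob \<xi> (Suc t) s))"
        using deviation_drift[OF \<eta>, of m] by (intro sum_mono) (simp add: \<xi>_def drift_def algebra_simps)
      also have "\<dots> = ?e * (1 - cont_prob \<xi> T s)"
        using sum_lessThan_telescope'[of "\<lambda>t. cont_prob \<xi> t s" T]
        by (simp add: sum_distrib_left[symmetric])
      also have "\<dots> \<le> ?e"
        using mu rho cont_prob_nonneg[OF \<xi>] by (intro mult_left_le) auto
      finally show ?thesis .
    qed
    then have "(\<integral>s. (\<Sum>t<T. drift \<xi> m t s) \<partial>signals) \<le> ?e"
      using integrable_drift(5)[OF \<xi>] by (intro integral_le_const) auto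
    moreover have "0 \<le> (\<integral>s. cont_prob \<xi> T s * v (state T s) $ m \<partial>signals)"
      using cont_prob_nonneg[OF \<xi>] v_nonneg by (intro integral_nonneg_AE) auto
    ultimately show ?thesis
      using payoff_tail[OF \<xi> game, of m T] integral_drift_sum[OF \<xi>, of m T] by linarith
  qed
  moreover have "(\<lambda>T. ?x + ?e + (\<integral>s. cont_prob \<xi> T s \<partial>signals)) \<longlonglongrightarrow> ?x + ?e + 0"
    using absorption[OF \<eta>] unfolding \<xi>_def by (intro tendsto_intros)
  ultimately show ?thesis
    unfolding \<xi>_def by (intro LIMSEQ_le_const[where a="payoff r (profile(m := \<eta>)) $ m"]) auto
qed

lemma payoff_profile_ge:
  "payoff r profile $ i \<ge> (\<Sum>l\<in>UNIV. \<beta> l * v l $ i) - \<rho> / \<mu>"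
proof -
  interpret prob_space signals by (rule prob_space_signals)
  note \<xi> = sunspot_profile_profile
  let ?x = "\<Sum>l\<in>UNIV. \<beta> l * v l $ i"
  let ?c = "\<lambda>T. \<integral>s. cont_prob profile T s \<partial>signals"
  \<comment> \<open>One \<open>?c T\<close> pays for the payoff tail, the other for the leftover
    \<open>cont_prob * v\<close>, where \<open>v\<close> is at most 1.\<close>
  have "payoff r profile $ i \<ge> ?x - \<rho> / \<mu> - 2 * ?c T" for T
  proof -
    have "- (\<rho> / \<mu>) \<le> (\<Sum>t<T. drift profile i t s)" for s
    proof -
      have "\<rho> / \<mu> * (1 - cont_prob profile T s) \<le> \<rho> / \<mu>"
        using mu rho cont_prob_nonneg[OF \<xi>] by (intro mult_left_le) auto
      then have "- (\<rho> / \<mu>) \<le> - (\<rho> / \<mu> * (1 - cont_prob profile T s))"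
        by simp
      also have "\<dots> = (\<Sum>t<T. - (\<rho> / \<mu> * (cont_prob profile t s - cont_prob profile (Suc t) s)))"
        using sum_lessThan_telescope'[of "\<lambda>t. cont_prob profile t s" T]
        by (simp add: sum_negf sum_distrib_left[symmetric] del: times_divide_eq_left)
      also have "\<dots> \<le> (\<Sum>t<T. drift profile i t s)"
        using profile_drift[of _ _ i] by (intro sum_mono) (simp add: drift_def algebra_simps)
      finally show ?thesis .
    qed
    then have "- (\<rho> / \<mu>) \<le> (\<integral>s. (\<Sum>t<T. drift profile i t s) \<partial>signals)"
      using integrable_drift(5)[OF \<xi>] by (intro integral_ge_const) auto
    moreover have "(\<integral>s. cont_prob profile T s * v (state T s) $ i \<partial>signals) \<le> ?c T"
      using integrable_drift(2,3)[OF \<xi>] cont_prob_nonneg[OF \<xi>] v_le_1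
      by (intro integral_mono) (auto intro: mult_left_le)
    ultimately show ?thesis
      using payoff_tail[OF \<xi> game, of i T] integral_drift_sum[OF \<xi>, of i T] by linarith
  qed
  moreover have "(\<lambda>T. ?x - \<rho> / \<mu> - 2 * ?c T) \<longlonglongrightarrow> ?x - \<rho> / \<mu> - 2 * 0"
    \<comment> \<open>The profile itself is the trivial deviation
      \<open>profile(i := profile i)\<close>.\<close>
    using absorption[of "profile i" i] \<xi> unfolding sunspot_profile_def
    by (intro tendsto_intros) auto
  ultimately show ?thesis
    by (intro LIMSEQ_le_const2[where a="payoff r profile $ i"]) auto
qed

lemma equilibrium_profile:
  assumes "\<epsilon> \<ge> 2 * (\<rho> / \<mu>) + \<mu>"
  shows "sunspot_eps_equilibrium r \<epsilon> profile"
  unfolding sunspot_eps_equilibrium_def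
proof (intro conjI allI impI sunspot_profile_profile)
  fix i \<eta>
  assume "sunspot_strategy \<eta>"
  then show "payoff r (profile(i := \<eta>)) $ i \<le> payoff r profile $ i + \<epsilon>"
    using payoff_deviation_le[of \<eta> i] payoff_profile_ge[of i] assms by linarith
qed

lemma payoff_profile:
  "\<bar>payoff r profile $ i - (\<Sum>l\<in>UNIV. \<beta> l * v l $ i)\<bar> \<le> \<rho> / \<mu> + \<mu>"
  using payoff_deviation_le[of "profile i" i] payoff_profile_ge[of i] mu sunspot_profile_profile
  by (simp add: sunspot_profile_def)

end

subsection \<open>M-matrices\<close>

lemma M_matrixD:
  assumes "M_matrix K R"
  shows "Q_matrix K R"
    and "\<And>i. i \<in> K \<Longrightarrow> R i i = 0"
    and "\<And>i. i \<in> K \<Longrightarrow> \<exists>j\<in>K. R i j > 0"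
    and "\<And>j. j \<in> K \<Longrightarrow> \<exists>i\<in>K. R i j > 0"
    and "\<And>i j j'. \<lbrakk>i \<in> K; j \<in> K; j' \<in> K; R i j > 0; R i j' > 0\<rbrakk> \<Longrightarrow> j = j'"
    and "\<And>i i' j. \<lbrakk>i \<in> K; i' \<in> K; j \<in> K; R i j > 0; R i' j > 0\<rbrakk> \<Longrightarrow> i = i'"
  using assms unfolding M_matrix_def by blast+

text \<open>In row \<open>i\<close> all entries outside column \<open>j\<close> are at most 0, and
  \<open>b\<close> vanishes at \<open>j\<close>. This is the Z-matrix sign pattern up to a
  permutation of columns.\<close>

lemma row_sum_nonpos:
  assumes M: "M_matrix K R" and "i \<in> K" "j \<in> K" "R i j > 0"
    and b: "\<And>l. l \<in> K \<Longrightarrow> b l \<ge> 0" and "b j = 0"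
  shows "(\<Sum>l\<in>K. R i l * b l) \<le> 0"
proof (rule sum_nonpos)
  fix l assume l: "l \<in> K"
  show "R i l * b l \<le> 0"
  proof (cases "l = j")
    case False
    then have "R i l \<le> 0"
      using M_matrixD(5)[OF M \<open>i \<in> K\<close> \<open>j \<in> K\<close> l \<open>R i j > 0\<close>] by force
    then show ?thesis using b[OF l] by (rule mult_nonpos_nonneg)
  qed (simp add: assms)
qed

text \<open>The complementarity problem for \<open>q = -1\<close> gives \<open>Rz \<ge> 1\<close>.
  If \<open>z j\<close> were 0, the row with its positive entry in column \<open>j\<close> would
  contradict this by \<open>row_sum_nonpos\<close>.\<close>

lemma M_matrix_positive_vector:
  assumes M: "M_matrix K R"
  obtains z where "\<And>j. j \<in> K \<Longrightarrow> z j > 0" "\<And>i. i \<in> K \<Longrightarrow> (\<Sum>j\<in>K. R i j * z j) \<ge> 1"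
proof -
  obtain z w where zw: "\<forall>i\<in>K. z i \<ge> 0 \<and> w i \<ge> 0 \<and> w i = -1 + (\<Sum>j\<in>K. R i j * z j) \<and> z i * w i = 0"
    using M_matrixD(1)[OF M] unfolding Q_matrix_def by (elim allE[where x="\<lambda>_. -1"]) blast
  then have Rz: "(\<Sum>j\<in>K. R i j * z j) \<ge> 1" if "i \<in> K" for i
    using that by force
  have "z j > 0" if j: "j \<in> K" for j
  proof (rule ccontr)
    assume "\<not> z j > 0"
    then have "z j = 0" using zw j by force
    obtain i where "i \<in> K" "R i j > 0" using M_matrixD(4)[OF M j] by blast
    with row_sum_nonpos[OF M this(1) j this(2), of z] \<open>z j = 0\<close> zw Rz[of i] show False by force
  qed
  with Rz show thesis by (rule that[rotated])
qed

text \<open>Minimal-ratio argument: if \<open>a\<close> had a negative coordinate, a multiple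
  \<open>t * z\<close> would lift it to a nonnegative \<open>b\<close> with a zero at
  \<open>j\<close>. The row that is positive in column \<open>j\<close> then gives at most 0 on
  \<open>b\<close>, but \<open>Ra \<ge> 0\<close> and \<open>Rz \<ge> 1\<close> give at least
  \<open>t > 0\<close>.\<close>

lemma M_matrix_inverse_nonneg:
  fixes a :: "'a \<Rightarrow> real"
  assumes M: "M_matrix K R" and fin: "finite K"
    and Ra: "\<And>i. i \<in> K \<Longrightarrow> (\<Sum>j\<in>K. R i j * a j) \<ge> 0" and "j0 \<in> K"
  shows "a j0 \<ge> 0"
proof (rule ccontr)
  assume neg: "\<not> a j0 \<ge> 0"
  obtain z where z: "\<And>j. j \<in> K \<Longrightarrow> z j > 0" "\<And>i. i \<in> K \<Longrightarrow> (\<Sum>j\<in>K. R i j * z j) \<ge> 1"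
    using M_matrix_positive_vector[OF M] by blast
  obtain j where j: "j \<in> K" "\<And>l. l \<in> K \<Longrightarrow> a j / z j \<le> a l / z l"
    using ex_is_arg_min_if_finite[OF fin, of "\<lambda>l. a l / z l"] \<open>j0 \<in> K\<close>
    by (auto simp: is_arg_min_linorder)
  define t where "t = - (a j / z j)"
  have "a j0 / z j0 < 0" using neg z(1)[OF \<open>j0 \<in> K\<close>] by (simp add: divide_neg_pos)
  then have t: "t > 0" using j(2)[OF \<open>j0 \<in> K\<close>] by (simp add: t_def)
  define b where "b l = a l + t * z l" for l
  have "b l \<ge> 0" if "l \<in> K" for l
    using j(2)[OF that] z(1)[OF that] by (simp add: b_def t_def field_simps)
  moreover have "b j = 0" using z(1)[OF j(1)] by (simp add: b_def t_def)
  moreover obtain i where i: "i \<in> K" "R i j > 0" using M_matrixD(4)[OF M j(1)] by blast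
  ultimately have "(\<Sum>l\<in>K. R i l * b l) \<le> 0"
    using row_sum_nonpos[OF M i(1) j(1) i(2)] by blast
  moreover have "(\<Sum>l\<in>K. R i l * b l) = (\<Sum>l\<in>K. R i l * a l) + t * (\<Sum>l\<in>K. R i l * z l)"
    by (simp add: b_def algebra_simps sum.distrib sum_distrib_left)
  moreover have "t * (\<Sum>l\<in>K. R i l * z l) \<ge> t * 1"
    using z(2)[OF i(1)] t by (intro mult_left_mono) auto
  ultimately show False using Ra[OF i(1)] t by linarith
qed

text \<open>Inverse positivity is applied to \<open>a - b\<close> and to
  \<open>b - a\<close>.\<close>

lemma M_matrix_injective:
  fixes a :: "'a \<Rightarrow> real"
  assumes M: "M_matrix K R" and fin: "finite K"
    and Ra: "\<And>i. i \<in> K \<Longrightarrow> (\<Sum>j\<in>K. R i j * a j) = (\<Sum>j\<in>K. R i j * b j)" and "j \<in> K"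
  shows "a j = b j"
proof -
  have "(\<Sum>j\<in>K. R i j * (a j - b j)) \<ge> 0" "(\<Sum>j\<in>K. R i j * (b j - a j)) \<ge> 0" if "i \<in> K" for i
    using Ra[OF that] by (simp_all add: algebra_simps sum_subtractf)
  from M_matrix_inverse_nonneg[OF M fin this(1) \<open>j \<in> K\<close>]
    M_matrix_inverse_nonneg[OF M fin this(2) \<open>j \<in> K\<close>] show ?thesis by linarith
qed

lemma M_matrix_surjective:
  fixes R :: "'a::finite \<Rightarrow> 'a \<Rightarrow> real"
  assumes M: "M_matrix K R"
  obtains a where "\<And>i. i \<in> K \<Longrightarrow> (\<Sum>j\<in>K. R i j * a j) = u i"
proof -
  \<comment> \<open>Extending the matrix by the identity outside \<open>K\<close> makes it an
    endomorphism of \<open>real^'a\<close>, where injectivity implies surjectivity.\<close>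
  define f :: "real^'a \<Rightarrow> real^'a" where
    "f a = (\<chi> i. if i \<in> K then \<Sum>j\<in>K. R i j * a $ j else a $ i)" for a
  have lin: "linear f"
    by (rule linearI) (auto simp: f_def vec_eq_iff algebra_simps sum.distrib sum_distrib_left)
  have "inj f"
  proof (rule injI)
    fix a b assume eq: "f a = f b"
    have "a $ j = b $ j" for j
    proof (cases "j \<in> K")
      case True
      have "(\<Sum>j\<in>K. R i j * a $ j) = (\<Sum>j\<in>K. R i j * b $ j)" if "i \<in> K" for i
        using arg_cong[OF eq, of "\<lambda>x. x $ i"] that by (simp add: f_def)
      from M_matrix_injective[OF M finite this True] show ?thesis .
    next
      case False
      then show ?thesis using arg_cong[OF eq, of "\<lambda>x. x $ j"] by (simp add: f_def)
    qed
    then show "a = b" by (simp add: vec_eq_iff)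
  qed
  then have "surj f" using lin by (rule linear_inj_imp_surj[rotated])
  then obtain a where a: "f a = (\<chi> i. u i)" by (metis surjD)
  show thesis
  proof (rule that)
    fix i assume "i \<in> K"
    then show "(\<Sum>j\<in>K. R i j * a $ j) = u i"
      using arg_cong[OF a, of "\<lambda>x. x $ i"] by (simp add: f_def)
  qed
qed

text \<open>
  The linear complementarity problem is solved with \<open>q = -1\<close> at the row \<open>k\<close> whose positive entry
  is in column \<open>j\<close>, and \<open>q = 1\<close> elsewhere: this forces \<open>z j > 0\<close>, hence \<open>w j = 0\<close>.
\<close>
lemma M_matrix_negative_entry:
  assumes M: "M_matrix K R" and j: "j \<in> K"
  obtains l where "l \<in> K" "R j l < 0"
proof -
  obtain k where k: "k \<in> K" "R k j > 0" using M_matrixD(4)[OF M j] by blast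
  have "k \<noteq> j" using M_matrixD(2)[OF M j] k by auto
  obtain z w where zw: "\<forall>i\<in>K. z i \<ge> 0 \<and> w i \<ge> 0
      \<and> w i = (if i = k then -1 else 1) + (\<Sum>j\<in>K. R i j * z j) \<and> z i * w i = 0"
    using M_matrixD(1)[OF M] unfolding Q_matrix_def
    by (elim allE[where x="\<lambda>i. if i = k then -1 else 1"]) blast
  have "z j \<noteq> 0"
  proof
    assume "z j = 0"
    with row_sum_nonpos[OF M k(1) j k(2), of z] zw k(1) show False by force
  qed
  then have "(\<Sum>l\<in>K. R j l * z l) < 0"
    using zw j \<open>k \<noteq> j\<close> by force
  then obtain l where "l \<in> K" "R j l * z l < 0"
    by (meson not_le sum_nonneg)
  then show thesis
    using zw that[of l] by (auto simp: mult_less_0_iff not_less[symmetric])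
qed

text \<open>In the round that discards \<open>i\<close>, player \<open>j\<close> is still present,
  and \<open>i\<close> is discarded because no other remaining player gives her a payoff at most 0
  by quitting alone. This makes the vertices nonnegative outside the normal players.\<close>

lemma not_normal_payoff_pos:
  assumes "i \<notin> normal_players r" "j \<in> normal_players r"
  shows "r {j} $ i > 0"
proof -
  obtain l where "i \<notin> normal_iter r l" using assms(1) by (auto simp: normal_players_def)
  then obtain l where l: "i \<notin> normal_iter r l" "\<And>l'. l' < l \<Longrightarrow> i \<in> normal_iter r l'"
    using exists_least_iff[of "\<lambda>l. i \<notin> normal_iter r l"] by auto
  obtain l' where l': "l = Suc l'"
    using l(1) by (cases l) auto
  have "j \<in> normal_iter r l'" "j \<noteq> i"
    using assms by (auto simp: normal_players_def)
  then show ?thesis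
    using l l' by force
qed

text \<open>Weights are indexed by \<open>K\<close>, as \<open>f\<close> may identify indices. The
  set \<open>T\<close> of affine combinations is convex and contains the generators, hence the
  hull.\<close>

lemma convex_hull_image_weights:
  fixes f :: "'a \<Rightarrow> 'b::real_vector"
  assumes "finite K" "x \<in> convex hull (f ` K)"
  obtains b where "sum b K = 1" "x = (\<Sum>j\<in>K. b j *\<^sub>R f j)"
proof -
  define T where "T = {y. \<exists>b. sum b K = 1 \<and> y = (\<Sum>j\<in>K. b j *\<^sub>R f j)}"
  have "f ` K \<subseteq> T"
  proof
    fix y assume "y \<in> f ` K"
    then obtain j where "j \<in> K" "y = f j" by blast
    then show "y \<in> T"
      using assms(1) unfolding T_def
      by (auto intro!: exI[of _ "\<lambda>l. if l = j then 1 else 0"] simp: if_distrib[of "\<lambda>x. x *\<^sub>R _"] cong: if_cong)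
  qed
  moreover have "convex T"
  proof (rule convexI)
    fix y y' and u u' :: real
    assume "y \<in> T" "y' \<in> T" "u + u' = 1"
    then obtain b b' where "sum b K = 1" "y = (\<Sum>j\<in>K. b j *\<^sub>R f j)"
      "sum b' K = 1" "y' = (\<Sum>j\<in>K. b' j *\<^sub>R f j)"
      by (auto simp: T_def)
    then show "u *\<^sub>R y + u' *\<^sub>R y' \<in> T"
      using \<open>u + u' = 1\<close> unfolding T_def
      by (auto intro!: exI[of _ "\<lambda>j. u * b j + u' * b' j"]
          simp: sum.distrib sum_distrib_left[symmetric] scaleR_right.sum scaleR_left_distrib)
  qed
  ultimately have "x \<in> T"
    using hull_minimal[of "f ` K" T convex] assms(2) by blast
  then show thesis using that by (auto simp: T_def)
qed

subsection \<open>Vertices of the payoff simplex\<close>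

text \<open>Here \<open>a k\<close> is column \<open>k\<close> of the inverse matrix,
  \<open>s k\<close> its sum, and \<open>v k\<close> the payoff of the lottery
  \<open>a k / s k\<close>. As \<open>1 / s k\<close> is the only nonzero normal coordinate of
  \<open>v k\<close>, the numbers \<open>y $ k * s k\<close> are barycentric coordinates on the
  affine hull.\<close>

lemma vertex_decomposition:
  fixes r :: "'n::finite set \<Rightarrow> real^'n"
  assumes M: "M_matrix K (hatR r)"
  obtains v s where "\<And>k. k \<in> K \<Longrightarrow> s k > 0"
    and "\<And>k i. k \<in> K \<Longrightarrow> i \<in> K \<Longrightarrow> v k $ i = (if i = k then 1 / s k else 0)"
    and "\<And>k. k \<in> K \<Longrightarrow> \<exists>b. (\<forall>j\<in>K. b j \<ge> 0) \<and> sum b K = 1 \<and> v k = (\<Sum>j\<in>K. b j *\<^sub>R r {j})"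
    and "\<And>b y. \<lbrakk>sum b K = 1; y = (\<Sum>j\<in>K. b j *\<^sub>R r {j})\<rbrakk> \<Longrightarrow>
      (\<Sum>k\<in>K. y $ k * s k) = 1 \<and> y = (\<Sum>k\<in>K. (y $ k * s k) *\<^sub>R v k)"
proof -
  let ?R = "hatR r"
  have "\<exists>a. \<forall>i\<in>K. (\<Sum>j\<in>K. ?R i j * a j) = (if i = k then 1 else 0)" for k
    using M_matrix_surjective[OF M, of "\<lambda>i. if i = k then 1 else 0"] by metis
  then obtain a where a: "\<And>k i. i \<in> K \<Longrightarrow> (\<Sum>j\<in>K. ?R i j * a k j) = (if i = k then 1 else 0)"
    by metis
  have a_nonneg: "a k j \<ge> 0" if "j \<in> K" for k j
  proof (rule M_matrix_inverse_nonneg[OF M finite _ that])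
    fix i assume "i \<in> K"
    then show "(\<Sum>j\<in>K. ?R i j * a k j) \<ge> 0" using a[of i k] by simp
  qed
  define s where "s k = sum (a k) K" for k
  define v where "v k = (\<Sum>j\<in>K. (a k j / s k) *\<^sub>R r {j})" for k
  have s: "s k > 0" if "k \<in> K" for k
  proof (rule ccontr)
    assume "\<not> s k > 0"
    then have "sum (a k) K = 0"
      using a_nonneg unfolding s_def by (meson leI order.antisym sum_nonneg)
    then have "\<forall>j\<in>K. a k j = 0"
      using a_nonneg by (subst (asm) sum_nonneg_eq_0_iff) auto
    then show False using a[OF that, of k] by simp
  qed
  show thesis
  proof (rule that[of s v])
    fix k assume k: "k \<in> K"
    show "s k > 0" using s k by blast
    show "v k $ i = (if i = k then 1 / s k else 0)" if "i \<in> K" for i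
    proof -
      have "v k $ i = (\<Sum>j\<in>K. ?R i j * a k j) / s k"
        by (simp add: v_def hatR_def sum_divide_distrib mult.commute)
      then show ?thesis using a[OF that] by simp
    qed
    show "\<exists>b. (\<forall>j\<in>K. b j \<ge> 0) \<and> sum b K = 1 \<and> v k = (\<Sum>j\<in>K. b j *\<^sub>R r {j})"
    proof (intro exI conjI)
      show "\<forall>j\<in>K. a k j / s k \<ge> 0" using a_nonneg s[OF k] by simp
      show "(\<Sum>j\<in>K. a k j / s k) = 1" using s[OF k] by (simp add: sum_divide_distrib[symmetric] s_def)
    qed (simp add: v_def)
  next
    fix b y
    assume b: "sum b K = 1" and y: "y = (\<Sum>j\<in>K. b j *\<^sub>R r {j})"
    \<comment> \<open>The weights are recovered from \<open>y\<close> by applying the inverse matrix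
      to its normal coordinates.\<close>
    have b_eq: "b j = (\<Sum>k\<in>K. y $ k * a k j)" if "j \<in> K" for j
    proof (rule M_matrix_injective[OF M finite _ that])
      fix i assume i: "i \<in> K"
      have "(\<Sum>j\<in>K. ?R i j * (\<Sum>k\<in>K. y $ k * a k j)) = (\<Sum>k\<in>K. \<Sum>j\<in>K. ?R i j * (y $ k * a k j))"
        unfolding sum_distrib_left by (rule sum.swap)
      also have "\<dots> = (\<Sum>k\<in>K. y $ k * (\<Sum>j\<in>K. ?R i j * a k j))"
        by (simp add: sum_distrib_left mult.left_commute)
      also have "\<dots> = y $ i"
        using a[OF i] i by (simp add: if_distrib[of "\<lambda>x. _ * x"] cong: if_cong)
      also have "\<dots> = (\<Sum>j\<in>K. ?R i j * b j)"
        by (simp add: y hatR_def mult.commute)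
      finally show "(\<Sum>j\<in>K. ?R i j * b j) = (\<Sum>j\<in>K. ?R i j * (\<Sum>k\<in>K. y $ k * a k j))" ..
    qed
    have "(\<Sum>k\<in>K. y $ k * s k) = (\<Sum>j\<in>K. \<Sum>k\<in>K. y $ k * a k j)"
      unfolding s_def sum_distrib_left by (rule sum.swap)
    also have "\<dots> = 1" using b b_eq by simp
    finally have "(\<Sum>k\<in>K. y $ k * s k) = 1" .
    moreover have "(\<Sum>k\<in>K. (y $ k * s k) *\<^sub>R v k) = y"
    proof -
      have "(\<Sum>k\<in>K. (y $ k * s k) *\<^sub>R v k) = (\<Sum>k\<in>K. \<Sum>j\<in>K. (y $ k * a k j) *\<^sub>R r {j})"
        using s by (intro sum.cong refl) (force simp: v_def scaleR_right.sum)
      also have "\<dots> = (\<Sum>j\<in>K. \<Sum>k\<in>K. (y $ k * a k j) *\<^sub>R r {j})"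
        by (rule sum.swap)
      also have "\<dots> = (\<Sum>j\<in>K. b j *\<^sub>R r {j})"
        by (intro sum.cong refl) (simp add: b_eq scaleR_left.sum)
      finally show ?thesis by (simp add: y)
    qed
    ultimately show "(\<Sum>k\<in>K. y $ k * s k) = 1 \<and> y = (\<Sum>k\<in>K. (y $ k * s k) *\<^sub>R v k)"
      by simp
  qed
qed

text \<open>
  The states are all players instead of the normal ones; \<open>c\<close> retracts them onto \<open>K\<close>, and no mass
  is ever put outside \<open>K\<close>.
\<close>
lemma sunspot_eps_equilibrium_exists:
  fixes r :: "'n::finite set \<Rightarrow> real^'n" and x :: "real^'n"
  assumes game: "quitting_game r" and solo: "\<forall>i. r {i} $ i = 0"
    and M: "M_matrix (normal_players r) (hatR r)"
    and x: "x \<in> convex hull ((\<lambda>i. r {i}) ` normal_players r)" "\<forall>i. x $ i \<ge> 0"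
    and \<epsilon>: "\<epsilon> > 0"
  shows "\<exists>\<xi>. sunspot_eps_equilibrium r \<epsilon> \<xi> \<and> (\<forall>i. \<bar>payoff r \<xi> $ i - x $ i\<bar> \<le> \<epsilon>)"
proof -
  define K where "K = normal_players r"
  note M = M[folded K_def] and x = x(1)[folded K_def] x(2)
  obtain v s where s: "\<And>k. k \<in> K \<Longrightarrow> s k > 0"
    and v_K: "\<And>k i. k \<in> K \<Longrightarrow> i \<in> K \<Longrightarrow> v k $ i = (if i = k then 1 / s k else 0)"
    and v_conv: "\<And>k. k \<in> K \<Longrightarrow> \<exists>b. (\<forall>j\<in>K. b j \<ge> 0) \<and> sum b K = 1 \<and> v k = (\<Sum>j\<in>K. b j *\<^sub>R r {j})"
    and decomp: "\<And>b y. \<lbrakk>sum b K = 1; y = (\<Sum>j\<in>K. b j *\<^sub>R r {j})\<rbrakk> \<Longrightarrow>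
      (\<Sum>k\<in>K. y $ k * s k) = 1 \<and> y = (\<Sum>k\<in>K. (y $ k * s k) *\<^sub>R v k)"
    by (rule vertex_decomposition[OF M]) (rule that)
  have v_bounds: "0 \<le> v k $ i \<and> v k $ i \<le> 1" if k: "k \<in> K" for k i
  proof -
    obtain b where b: "\<forall>j\<in>K. b j \<ge> 0" "sum b K = 1" "v k = (\<Sum>j\<in>K. b j *\<^sub>R r {j})"
      using v_conv[OF k] by (elim exE conjE) (rule that)
    have "v k $ i \<le> (\<Sum>j\<in>K. b j)"
      unfolding b(3) using b(1) abs_payoff_le_1[OF game]
      by (auto simp: abs_le_iff intro!: sum_mono mult_left_le)
    moreover have "0 \<le> v k $ i"
    proof (cases "i \<in> K")
      case True
      then show ?thesis using v_K[OF k] s[OF k] by simp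
    next
      case False
      then have "r {j} $ i \<ge> 0" if "j \<in> K" for j
        using not_normal_payoff_pos[of i r j] that by (simp add: K_def)
      then show ?thesis
        unfolding b(3) using b(1) by (auto intro!: sum_nonneg)
    qed
    ultimately show ?thesis using b(2) by simp
  qed
  obtain J where J: "\<And>k. k \<in> K \<Longrightarrow> J k \<in> K \<and> hatR r k (J k) > 0"
    using M_matrixD(3)[OF M] by metis
  have J_neq: "J k \<noteq> k" if "k \<in> K" for k
    using J[OF that] M_matrixD(2)[OF M that] by force
  \<comment> \<open>Take a negative entry of row \<open>J k\<close>, in column \<open>j\<close>, and
    the row \<open>l\<close> positive in that column. Then \<open>l \<noteq> J k\<close> by sign,
    and \<open>l = k\<close> would force \<open>j = J k\<close>, a zero diagonal entry.\<close>
  have "\<exists>l\<in>K. l \<noteq> k \<and> l \<noteq> J k" if k: "k \<in> K" for k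
  proof -
    obtain j where j: "j \<in> K" "hatR r (J k) j < 0"
      using M_matrix_negative_entry[OF M] J[OF k] by blast
    obtain l where l: "l \<in> K" "hatR r l j > 0"
      using M_matrixD(4)[OF M j(1)] by blast
    have "l \<noteq> J k" using j l by auto
    moreover have "l \<noteq> k"
    proof
      assume "l = k"
      then have "j = J k" using M_matrixD(5)[OF M k j(1), of "J k"] J[OF k] l by auto
      then show False using j M_matrixD(2)[OF M, of "J k"] by simp
    qed
    ultimately show ?thesis using l by blast
  qed
  then obtain \<kappa> where \<kappa>: "\<And>k. k \<in> K \<Longrightarrow> \<kappa> k \<in> K \<and> \<kappa> k \<noteq> k \<and> \<kappa> k \<noteq> J k"
    by metis
  \<comment> \<open>\<open>J\<close> is injective on \<open>K\<close>, since a column has only one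
    positive entry; so moving to \<open>\<kappa> k\<close> changes the designated quitter.\<close>
  have J_\<kappa>: "J (\<kappa> k) \<noteq> J k" if "k \<in> K" for k
    using M_matrixD(6)[OF M, of "\<kappa> k" k "J k"] \<kappa>[OF that] J[OF that] J[of "\<kappa> k"] that by auto

  obtain b where b: "sum b K = 1" "x = (\<Sum>j\<in>K. b j *\<^sub>R r {j})"
    using convex_hull_image_weights[OF _ x(1)] by (metis finite)
  then have "K \<noteq> {}" by auto
  then obtain k0 where k0: "k0 \<in> K" by blast
  define c where "c k = (if k \<in> K then k else k0)" for k
  have c: "c k \<in> K" for k using k0 by (simp add: c_def)
  have c_K: "c k = k" if "k \<in> K" for k using that by (simp add: c_def)

  \<comment> \<open>The bound \<open>1 / s k\<close> keeps \<open>y k\<close> nonnegative in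
    coordinate \<open>k\<close>, and \<open>\<epsilon> / 3\<close> is used because the total error
    \<open>2 * (\<rho> / \<mu>) + \<mu>\<close> will be \<open>3 * \<mu>\<close>.\<close>
  define \<mu> where "\<mu> = Min (insert (1 / 2) (insert (\<epsilon> / 3) ((\<lambda>k. 1 / s k) ` K)))"
  have mu: "0 < \<mu>" "\<mu> \<le> 1 / 2" "\<mu> \<le> \<epsilon> / 3" "\<And>k. k \<in> K \<Longrightarrow> \<mu> \<le> 1 / s k"
  proof -
    show "0 < \<mu>" using \<epsilon> s unfolding \<mu>_def by (subst Min_gr_iff) auto
    show "\<mu> \<le> 1 / 2" "\<mu> \<le> \<epsilon> / 3" unfolding \<mu>_def by (rule Min_le; simp)+
    show "\<mu> \<le> 1 / s k" if "k \<in> K" for k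
      using that unfolding \<mu>_def by (intro Min_le) auto
  qed
  define \<rho> where "\<rho> = \<mu>\<^sup>2"
  have rho: "0 < \<rho>" "\<rho> \<le> 1" "\<rho> / \<mu> = \<mu>"
  proof -
    show "0 < \<rho>" "\<rho> / \<mu> = \<mu>" using mu by (simp_all add: \<rho>_def power2_eq_square)
    show "\<rho> \<le> 1" using mu unfolding \<rho>_def by (intro power_le_one) auto
  qed

  define y where "y k = (1 / (1 - \<mu>)) *\<^sub>R (v k - \<mu> *\<^sub>R r {J k})" for k
  have y: "(\<Sum>l\<in>K. y k $ l * s l) = 1" "y k = (\<Sum>l\<in>K. (y k $ l * s l) *\<^sub>R v l)"
    if k: "k \<in> K" for k
  proof -
    obtain b where b: "sum b K = 1" "v k = (\<Sum>j\<in>K. b j *\<^sub>R r {j})"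
      using v_conv[OF k] by (elim exE conjE) (rule that)
    \<comment> \<open>The weights of \<open>v k\<close> with \<open>\<mu>\<close> taken away from
      \<open>J k\<close>, rescaled to total 1. They may be negative; positivity enters only through
      \<open>y_nonneg\<close>.\<close>
    define b' where "b' j = (b j - (if j = J k then \<mu> else 0)) / (1 - \<mu>)" for j
    have "sum b' K = 1"
      using J[OF k] b(1) mu by (simp add: b'_def sum_divide_distrib[symmetric] sum_subtractf)
    moreover have "y k = (\<Sum>j\<in>K. b' j *\<^sub>R r {j})"
    proof -
      have "(\<Sum>j\<in>K. b' j *\<^sub>R r {j}) = (1 / (1 - \<mu>)) *\<^sub>R (\<Sum>j\<in>K. b j *\<^sub>R r {j} - (if j = J k then \<mu> else 0) *\<^sub>R r {j})"
        by (simp add: b'_def scaleR_right.sum scaleR_left_diff_distrib divide_inverse_commute scaleR_right_diff_distrib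
          flip: scaleR_scaleR)
      also have "(\<Sum>j\<in>K. b j *\<^sub>R r {j} - (if j = J k then \<mu> else 0) *\<^sub>R r {j}) = v k - \<mu> *\<^sub>R r {J k}"
        using J[OF k] by (simp add: sum_subtractf b(2) if_distrib[of "\<lambda>x. x *\<^sub>R _"] cong: if_cong)
      finally show ?thesis by (simp add: y_def)
    qed
    ultimately show "(\<Sum>l\<in>K. y k $ l * s l) = 1" "y k = (\<Sum>l\<in>K. (y k $ l * s l) *\<^sub>R v l)"
      using decomp by blast+
  qed
  have y_eq: "(1 - \<mu>) * y k $ i = v k $ i - \<mu> * r {J k} $ i" for k i
    using mu by (simp add: y_def)
  have y_nonneg: "y k $ i \<ge> 0" if k: "k \<in> K" and i: "i \<in> K" for k i
  proof -
    have "\<mu> * r {J k} $ i \<le> v k $ i"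
    proof (cases "i = k")
      case True
      have "\<mu> * r {J k} $ i \<le> \<mu> * 1"
        using abs_payoff_le_1[OF game, of "{J k}" i] mu by (intro mult_left_mono) auto
      then show ?thesis using mu(4)[OF k] v_K[OF k i] True by simp
    next
      case False
      \<comment> \<open>Column \<open>J k\<close> has its only positive entry in row
        \<open>k\<close>.\<close>
      have "\<not> hatR r i (J k) > 0"
        using M_matrixD(6)[OF M i k] J[OF k] False by blast
      then show ?thesis
        using v_K[OF k i] False mu by (simp add: hatR_def mult_nonneg_nonpos)
    qed
    then have "0 \<le> (1 - \<mu>) * y k $ i" using y_eq[of k i] by simp
    then show ?thesis using mu by (simp add: zero_le_mult_iff)
  qed
  \<comment> \<open>The barycentric coordinates of \<open>y k\<close> are now nonnegative, so
    \<open>y k\<close> is a convex combination of the vertices.\<close>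
  have y_bounds: "0 \<le> y k $ i \<and> y k $ i \<le> 1" if k: "k \<in> K" for k i
  proof -
    have w: "0 \<le> y k $ l * s l" if "l \<in> K" for l
      using y_nonneg[OF k that] s[OF that] by simp
    have eq: "y k $ i = (\<Sum>l\<in>K. (y k $ l * s l) * v l $ i)"
      by (subst y(2)[OF k]) simp
    have "(\<Sum>l\<in>K. (y k $ l * s l) * v l $ i) \<le> (\<Sum>l\<in>K. y k $ l * s l)"
      using w v_bounds by (intro sum_mono mult_left_le) auto
    moreover have "(\<Sum>l\<in>K. (y k $ l * s l) * v l $ i) \<ge> 0"
      using y_nonneg[OF k] s v_bounds
      by (intro sum_nonneg mult_nonneg_nonneg) (auto simp: less_imp_le)
    ultimately show ?thesis using eq y(1)[OF k] by simp
  qed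

  \<comment> \<open>With probability \<open>1 - \<rho>\<close> the next vertex is drawn with the
    barycentric coordinates of \<open>y\<close>, and with probability \<open>\<rho>\<close> it is
    \<open>\<kappa>\<close>. The initial law \<open>\<beta>\<close> consists of the barycentric
    coordinates of \<open>x\<close>.\<close>
  define P where "P k l = (1 - \<rho>) * (if l \<in> K then y (c k) $ l * s l else 0)
      + (if l = \<kappa> (c k) then \<rho> else 0)" for k l
  define \<beta> where "\<beta> l = (if l \<in> K then x $ l * s l else 0)" for l
  have P_nonneg: "0 \<le> P k l" for k l
    using y_nonneg[OF c] s rho by (auto simp: P_def less_imp_le)
  have P_apply: "(\<Sum>l\<in>UNIV. P k l * g l) = (1 - \<rho>) * (\<Sum>l\<in>K. y (c k) $ l * s l * g l) + \<rho> * g (\<kappa> (c k))"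
    for k and g :: "'n \<Rightarrow> real"
  proof -
    have "(\<Sum>l\<in>UNIV. P k l * g l) = (1 - \<rho>) * (\<Sum>l\<in>UNIV. if l \<in> K then y (c k) $ l * s l * g l else 0)
        + (\<Sum>l\<in>UNIV. if l = \<kappa> (c k) then \<rho> * g l else 0)"
      unfolding sum_distrib_left sum.distrib[symmetric] by (intro sum.cong) (auto simp: P_def algebra_simps)
    then show ?thesis by (simp add: sum.If_cases)
  qed
  have P_sum: "(\<Sum>l\<in>UNIV. P k l) = 1" for k
    using P_apply[of k "\<lambda>_. 1"] y(1)[OF c] by simp
  have P_v: "(\<Sum>l\<in>UNIV. P k l * v (c l) $ i) = (1 - \<rho>) * y (c k) $ i + \<rho> * v (\<kappa> (c k)) $ i" for k i
  proof -
    have "(\<Sum>l\<in>K. y (c k) $ l * s l * v (c l) $ i) = (\<Sum>l\<in>K. (y (c k) $ l * s l) *\<^sub>R v l) $ i"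
      by (simp add: c_K)
    also have "\<dots> = y (c k) $ i" using y(2)[OF c] by simp
    finally show ?thesis
      using P_apply[of k "\<lambda>l. v (c l) $ i"] \<kappa>[OF c] by (simp add: c_K)
  qed
  have \<beta>_apply: "(\<Sum>l\<in>UNIV. \<beta> l * g l) = (\<Sum>l\<in>K. x $ l * s l * g l)" for g :: "'n \<Rightarrow> real"
    by (simp add: \<beta>_def sum.If_cases if_distrib[of "\<lambda>x. x * _"] cong: if_cong)
  have \<beta>_nonneg: "0 \<le> \<beta> l" for l
    using x(2) s by (simp add: \<beta>_def less_imp_le)
  have \<beta>_sum: "(\<Sum>l\<in>UNIV. \<beta> l) = 1"
    using \<beta>_apply[of "\<lambda>_. 1"] decomp[OF b] by simp
  have \<beta>_v: "(\<Sum>l\<in>UNIV. \<beta> l * v (c l) $ i) = x $ i" for i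
  proof -
    have "(\<Sum>l\<in>UNIV. \<beta> l * v (c l) $ i) = (\<Sum>l\<in>K. (x $ l * s l) *\<^sub>R v l) $ i"
      by (simp add: \<beta>_apply c_K)
    then show ?thesis using decomp[OF b] by simp
  qed

  obtain start where start: "start \<in> borel \<rightarrow>\<^sub>M count_space UNIV"
    "\<And>f :: 'n \<Rightarrow> real. (\<integral>u. f (start u) \<partial>unit_uniform) = (\<Sum>l\<in>UNIV. \<beta> l * f l)"
    using sample_finite_distribution[of \<beta>, OF \<beta>_nonneg \<beta>_sum] by blast
  have "\<forall>k. \<exists>g \<in> borel \<rightarrow>\<^sub>M count_space UNIV.
      \<forall>f :: 'n \<Rightarrow> real. (\<integral>u. f (g u) \<partial>unit_uniform) = (\<Sum>l\<in>UNIV. P k l * f l)"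
    using sample_finite_distribution[OF P_nonneg P_sum] by blast
  then obtain step where step: "\<And>k. step k \<in> borel \<rightarrow>\<^sub>M count_space UNIV"
    "\<And>k. \<And>f :: 'n \<Rightarrow> real. (\<integral>u. f (step k u) \<partial>unit_uniform) = (\<Sum>l\<in>UNIV. P k l * f l)"
    by metis

  have error_bounds: "2 * (\<rho> / \<mu>) + \<mu> \<le> \<epsilon>" "\<rho> / \<mu> + \<mu> \<le> \<epsilon>"
    using mu unfolding rho(3) by auto
  interpret sunspot_chain r "\<lambda>k. J (c k)" "\<lambda>k. v (c k)" P \<beta> \<mu> \<rho> start step
  proof
    show "quitting_game r" "\<And>i. r {i} $ i = 0" using game solo by auto
    show "0 \<le> v (c k) $ i" "v (c k) $ i \<le> 1" for k i using v_bounds[OF c] by auto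
    show "0 < \<mu>" "\<mu> < 1" "0 < \<rho>" "\<rho> \<le> 1" using mu rho by auto
    show "\<bar>\<mu> * r {J (c k)} $ i + (1 - \<mu>) * (\<Sum>l\<in>UNIV. P k l * v (c l) $ i) - v (c k) $ i\<bar> \<le> \<rho>" for k i
    proof -
      \<comment> \<open>The vector \<open>y\<close> balances exactly, so only the jump to
        \<open>\<kappa>\<close> leaves an error.\<close>
      have "\<mu> * r {J (c k)} $ i + (1 - \<mu>) * (\<Sum>l\<in>UNIV. P k l * v (c l) $ i) - v (c k) $ i
          = \<rho> * ((1 - \<mu>) * (v (\<kappa> (c k)) $ i - y (c k) $ i))"
        unfolding P_v using y_eq[of "c k" i] by (simp add: algebra_simps)
      moreover have "\<bar>(1 - \<mu>) * (v (\<kappa> (c k)) $ i - y (c k) $ i)\<bar> \<le> 1"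
      proof -
        have "\<bar>v (\<kappa> (c k)) $ i - y (c k) $ i\<bar> \<le> 1"
          using v_bounds[of "\<kappa> (c k)" i] \<kappa>[OF c[of k]] y_bounds[OF c, of k i] by auto
        then show ?thesis
          unfolding abs_mult using mu by (intro mult_le_one) auto
      qed
      ultimately show ?thesis
        using rho by (simp add: abs_mult mult_left_le)
    qed
    show "(\<Sum>l\<in>UNIV. P k l * v (c l) $ J (c k)) = 0" for k
    proof -
      let ?k = "c k"
      \<comment> \<open>Player \<open>J ?k\<close> is neither \<open>?k\<close> nor
        \<open>\<kappa> ?k\<close>, the only normal players with a positive payoff at these two
        vertices.\<close>
      have "v ?k $ J ?k = 0" "v (\<kappa> ?k) $ J ?k = 0"
        using v_K J[OF c] J_neq[OF c] \<kappa>[OF c] c by (metis)+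
      moreover from this(1) have "y ?k $ J ?k = 0"
        using y_eq[of ?k "J ?k"] solo mu by simp
      ultimately show ?thesis unfolding P_v by simp
    qed
    show "\<rho> \<le> (\<Sum>l | J (c l) \<noteq> J (c k). P k l)" for k
    proof -
      have "\<rho> \<le> P k (\<kappa> (c k))"
        using y_nonneg[OF c] s \<kappa>[OF c] rho by (auto simp: P_def less_imp_le)
      also have "\<dots> \<le> (\<Sum>l | J (c l) \<noteq> J (c k). P k l)"
        using P_nonneg J_\<kappa>[OF c] \<kappa>[OF c] by (intro member_le_sum) (auto simp: c_K)
      finally show ?thesis .
    qed
  qed (use P_nonneg P_sum start step in auto)
  show ?thesis
  proof (intro exI conjI allI)
    show "sunspot_eps_equilibrium r \<epsilon> profile"
      using error_bounds(1) by (rule equilibrium_profile)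
    show "\<bar>payoff r profile $ i - x $ i\<bar> \<le> \<epsilon>" for i
      using payoff_profile[of i] error_bounds(2) unfolding \<beta>_v by linarith
  qed
qed

section \<open>Passage from approximate equilibria to the limit payoff\<close>

theorem theorem5:
  fixes r :: "'n::finite set \<Rightarrow> real^'n" and x :: "real^'n"
  assumes "quitting_game r"
    and "\<forall>i. r {i} $ i = 0"
    and "M_matrix (normal_players r) (hatR r)"
    and "x \<in> convex hull ((\<lambda>i. r {i}) ` normal_players r)"
    and "\<forall>i. x $ i \<ge> 0"
  shows "sunspot_eq_payoff r x"
proof -
  have "\<forall>\<epsilon>>0. \<exists>\<xi>. sunspot_eps_equilibrium r \<epsilon> \<xi> \<and> (\<forall>i. \<bar>payoff r \<xi> $ i - x $ i\<bar> \<le> \<epsilon>)"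
    using sunspot_eps_equilibrium_exists[OF assms] by blast
  then obtain \<Xi> where \<Xi>: "\<And>\<epsilon>. \<epsilon> > 0 \<Longrightarrow> sunspot_eps_equilibrium r \<epsilon> (\<Xi> \<epsilon>)"
    "\<And>\<epsilon> i. \<epsilon> > 0 \<Longrightarrow> \<bar>payoff r (\<Xi> \<epsilon>) $ i - x $ i\<bar> \<le> \<epsilon>"
    by metis
  have "((\<lambda>\<epsilon>. payoff r (\<Xi> \<epsilon>)) \<longlongrightarrow> x) (at_right 0)"
  proof (rule vec_tendstoI)
    fix i
    have "((\<lambda>\<epsilon>. payoff r (\<Xi> \<epsilon>) $ i - x $ i) \<longlongrightarrow> 0) (at_right 0)"
    proof (rule Lim_null_comparison)
      show "\<forall>\<^sub>F \<epsilon> in at_right 0. norm (payoff r (\<Xi> \<epsilon>) $ i - x $ i) \<le> \<epsilon>"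
        using \<Xi>(2) by (auto simp: eventually_at_right_field intro: exI[of _ 1])
      show "((\<lambda>\<epsilon>. \<epsilon>) \<longlongrightarrow> 0) (at_right (0::real))"
        by (rule tendsto_ident_at)
    qed
    then show "((\<lambda>\<epsilon>. payoff r (\<Xi> \<epsilon>) $ i) \<longlongrightarrow> x $ i) (at_right 0)"
      by (rule LIM_zero_cancel)
  qed
  with \<Xi>(1) show ?thesis
    unfolding sunspot_eq_payoff_def by blast
qed

end
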